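(* Let $1<p<\infty$ and let $\mu,\nu_+,\nu_-$ satisfy the standing assumptions below. Then $$\lim_{\epsilon\searrow0}\epsilon^{-1/p}\,W_p(\mu+\epsilon\nu_+,\mu+\epsilon\nu_-)=\|\nu\|_\mu^{1/p}.$$
   Context: $\Omega\subset\mathbb R^k$ is a compact set equal to the closure of its interior. For nonnegative measures of equal mass, $W_p(\mu_1,\mu_2):=\big(\inf_\pi\int|x-y|^p\,d\pi\big)^{1/p}$ over nonnegative $\pi$ on $\Omega\times\Omega$ with marginals $\mu_1,\mu_2$. Strong $d$-connectedness: a nonnegative measure $\mu$ is strongly $d$-connected if there exist $L,K>0$, an integer $N\ge2$ and a measure space $(D,\beta)$ with $0<\beta(D)<\infty$ such that for any $x_0,x_1\in\mathrm{supp}(\mu)$ there are $k\le N$ points $y_1=x_0,\dots,y_k=x_1$ in $\mathrm{supp}(\mu)$ and measurable $\Phi_j:[0,1]\times D\to\mathrm{supp}(\mu)$, $j=1,\dots,k-1$, with: (i) $s\mapsto\Phi_j(s,b)$ $L$-Lipschitz for each $b$; (ii) $\Phi_j$ injective on $(0,1)\times D$, $\Phi_j(0,b)=y_j$, $\Phi_j(1,b)=y_{j+1}$; (iii) $(\Phi_j)_\#\rho\le\mu$, $\rho(ds,db)=Ks^{d-1}(1-s)^{d-1}ds\,\beta(db)$. Standing assumptions: $\mu$ is a Borel probability measure on $\Omega$ with $\mu=\sum_{j=1}^m\mu_j$, $m\ge2$, where the $\mu_j$ are nonnegative measures whose supports $A_j:=\mathrm{supp}(\mu_j)$ are pairwise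 disjoint, and each $\mu_j$ is strongly $d_j$-connected for some $d_j\ge1$. $\nu_+,\nu_-$ are nonnegative finite Borel measures with $\nu_+(\Omega)=\nu_-(\Omega)$ and $\mathrm{supp}(\nu_+)\cup\mathrm{supp}(\nu_-)\subset\mathrm{supp}(\mu)$; $\nu:=\nu_+-\nu_-$. Graph data: $\bar\nu_j:=\nu(A_j)$ (so $\sum_j\bar\nu_j=0$); $V=\{1,\dots,m\}$, $V_+=\{j:\bar\nu_j>0\}$, $V_-=\{j:\bar\nu_j<0\}$. For $i,j\in V$, $|E|_{i,j}:=\mathrm{dist}^p(A_i,A_j)=\min_{x\in A_i,y\in A_j}|x-y|^p$. For $i,j\in V$, $|\bar E|_{i,j}:=\min\sum_{l=1}^{n-1}|E|_{k_l,k_{l+1}}$, the minimum over all finite sequences $k_1=i,k_2,\dots,k_n=j$ in $V$ (geodesic distance in the complete graph on $V$ with edge lengths $|E|$). Finally $$\|\nu\|_\mu:=\min_{\lambda}\sum_{i\in V_+}\sum_{j\in V_-}\lambda_{i,j}|\bar E|_{i,j},$$ the minimum over nonnegative $|V_+|\times|V_-|$ matrices $(\lambda_{i,j})$ with $\sum_{j\in V_-}\lambda_{i,j}=\bar\nu_i$ for $i\in V_+$ and $\sum_{i\in V_+}\lambda_{i,j}=-\bar\nu_j$ for $j\in V_-$. *)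

theory Defs
  imports "HOL-Probability.Probability"
begin

definition supp :: "'a::topological_space measure \<Rightarrow> 'a set" where
  "supp M = {x. \<forall>U. open U \<and> x \<in> U \<longrightarrow> emeasure M U > 0}"

definition add_measure :: "'a measure \<Rightarrow> 'a measure \<Rightarrow> 'a measure" where
  "add_measure M N = measure_of (space M) (sets M) (\<lambda>A. emeasure M A + emeasure N A)"

definition couplings :: "'a::euclidean_space set \<Rightarrow> 'a measure \<Rightarrow> 'a measure \<Rightarrow> ('a \<times> 'a) measure set" where
  "couplings \<Omega> M1 M2 = {\<pi>. sets \<pi> = sets borel \<and> emeasure \<pi> (UNIV - \<Omega> \<times> \<Omega>) = 0
      \<and> distr \<pi> borel fst = M1 \<and> distr \<pi> borel snd = M2}"

definition Wasserstein :: "real \<Rightarrow> 'a::euclidean_space set \<Rightarrow> 'a measure \<Rightarrow> 'a measure \<Rightarrow> real" where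
  "Wasserstein p \<Omega> M1 M2 =
     (enn2real (INF \<pi>\<in>couplings \<Omega> M1 M2. \<integral>\<^sup>+ z. ennreal (dist (fst z) (snd z) powr p) \<partial>\<pi>)) powr (1 / p)"

definition rho_measure :: "real \<Rightarrow> real \<Rightarrow> 'b measure \<Rightarrow> (real \<times> 'b) measure" where
  "rho_measure K d D =
     density (restrict_space lborel {0..1}) (\<lambda>s. ennreal (K * s powr (d - 1) * (1 - s) powr (d - 1)))
       \<Otimes>\<^sub>M D"

text \<open>Strong d-connectedness; the measure space (D,beta) lives in the type 'b.\<close>
definition strongly_d_connected :: "'b itself \<Rightarrow> real \<Rightarrow> 'a::euclidean_space measure \<Rightarrow> bool" where
  "strongly_d_connected _ d M \<longleftrightarrow>
    (\<exists>L>0. \<exists>K>0. \<exists>N::nat. N \<ge> 2 \<and> (\<exists>D::'b measure.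
       0 < emeasure D (space D) \<and> emeasure D (space D) < \<infinity> \<and>
       (\<forall>x0\<in>supp M. \<forall>x1\<in>supp M. \<exists>(n::nat) (y::nat \<Rightarrow> 'a) (\<Phi>::nat \<Rightarrow> real \<times> 'b \<Rightarrow> 'a).
          1 \<le> n \<and> n \<le> N \<and> y 1 = x0 \<and> y n = x1 \<and> (\<forall>i\<in>{1..n}. y i \<in> supp M) \<and>
          (\<forall>j\<in>{1..<n}.
             \<Phi> j \<in> measurable (rho_measure K d D) borel \<and>
             (\<forall>s\<in>{0..1}. \<forall>b\<in>space D. \<Phi> j (s, b) \<in> supp M) \<and>
             (\<forall>b\<in>space D. L-lipschitz_on {0..1} (\<lambda>s. \<Phi> j (s, b))) \<and>
             inj_on (\<Phi> j) ({0<..<1} \<times> space D) \<and>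
             (\<forall>b\<in>space D. \<Phi> j (0, b) = y j \<and> \<Phi> j (1, b) = y (Suc j)) \<and>
             (\<forall>A\<in>sets borel. emeasure (distr (rho_measure K d D) borel (\<Phi> j)) A \<le> emeasure M A)))))"

definition path_length :: "(nat \<Rightarrow> nat \<Rightarrow> real) \<Rightarrow> nat list \<Rightarrow> real" where
  "path_length E ks = (\<Sum>l<length ks - 1. E (ks ! l) (ks ! Suc l))"

definition geodesic_dist :: "nat set \<Rightarrow> (nat \<Rightarrow> nat \<Rightarrow> real) \<Rightarrow> nat \<Rightarrow> nat \<Rightarrow> real" where
  "geodesic_dist V E i j =
     Inf {path_length E ks | ks. ks \<noteq> [] \<and> hd ks = i \<and> last ks = j \<and> set ks \<subseteq> V}"

definition nu_bar :: "(nat \<Rightarrow> 'a::topological_space measure) \<Rightarrow> 'a measure \<Rightarrow> 'a measure \<Rightarrow> nat \<Rightarrow> real" where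
  "nu_bar mus nup num j = measure nup (supp (mus j)) - measure num (supp (mus j))"

definition edge_len :: "real \<Rightarrow> (nat \<Rightarrow> 'a::metric_space measure) \<Rightarrow> nat \<Rightarrow> nat \<Rightarrow> real" where
  "edge_len p mus i j = setdist (supp (mus i)) (supp (mus j)) powr p"

definition transport_norm ::
  "real \<Rightarrow> nat \<Rightarrow> (nat \<Rightarrow> 'a::metric_space measure) \<Rightarrow> 'a measure \<Rightarrow> 'a measure \<Rightarrow> real" where
  "transport_norm p m mus nup num =
     (let nb = nu_bar mus nup num; V = {1..m};
          Vp = {j\<in>V. nb j > 0}; Vm = {j\<in>V. nb j < 0};
          Eb = geodesic_dist V (edge_len p mus)
      in Inf {\<Sum>i\<in>Vp. \<Sum>j\<in>Vm. lam i j * Eb i j | lam::nat \<Rightarrow> nat \<Rightarrow> real.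
                (\<forall>i\<in>Vp. \<forall>j\<in>Vm. lam i j \<ge> 0) \<and>
                (\<forall>i\<in>Vp. (\<Sum>j\<in>Vm. lam i j) = nb i) \<and>
                (\<forall>j\<in>Vm. (\<Sum>i\<in>Vp. lam i j) = - nb j)})"

end

theory Submission
  imports Defs
begin

text \<open>Lower bound: for every coupling \<open>\<pi>\<close> the masses \<open>\<pi>(A\<^sub>i \<times> A\<^sub>j)\<close> form a flow with divergence
  \<open>\<epsilon> \<nu>(A\<^sub>i)\<close> and cost at most that of \<open>\<pi>\<close>. Rerouting the flow at each vertex, which the
  triangle inequality for the geodesic distance permits, turns it into an admissible matrix.

  Upper bound: move mass \<open>\<epsilon>\<close> along a chain of small blobs, each dominated by a multiple of \<open>\<mu>\<close>.
  The mass entering a blob may differ from the mass leaving it, since \<open>\<mu>\<close> supplies the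
  blobs when \<open>\<epsilon>\<close> is small; hence the costs of the links of a chain simply add up and no gluing of
  couplings is needed. A chain of \<open>n\<close> links along a curve of length \<open>L\<close> inside the support
  costs \<open>\<epsilon> n (L/n)\<^sup>p\<close>, which is negligible because \<open>p > 1\<close>, so only the jumps between different
  components count.\<close>

section \<open>Sums of measures and supports\<close>

text \<open>The order of limits shapes every notion below. A scheme that carries
  \<open>\<nu>p\<close> to \<open>\<nu>m\<close> is built once, without reference to \<epsilon>, and
  then multiplied by \<epsilon>. What it borrows from \<mu> is bounded by a constant that may
  explode as blobs shrink and chains get finer; but radius and number of links are fixed first, at
  the price of an error \<eta>, and only then does \<epsilon> tend to 0. The obstacle is that
  consecutive transports do not compose well: when plans of cost c and d are glued, Minkowski's
  inequality only bounds the cost by the p-th power of the sum of the p-th roots, which exceeds c +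
  d. With borrowed mass, each link instead moves its own share, like a queue in which everybody
  advances one place. This is the reason why edges have length dist^p and why a detour through other
  components can be cheaper than a direct jump. The lower bound needs no limit at all: it holds for
  each \<epsilon> > 0, because \<mu> cancels in the difference of the two marginals.\<close>

lemma space_add_measure [simp]: "space (add_measure M N) = space M"
  by (simp add: add_measure_def)

lemma sets_add_measure [simp, measurable_cong]: "sets (add_measure M N) = sets M"
  by (simp add: add_measure_def)

lemma emeasure_add_measure:
  assumes "sets M = sets N" "A \<in> sets M"
  shows "emeasure (add_measure M N) A = emeasure M A + emeasure N A"
proof -
  have "countably_additive (sets M) (\<lambda>A. emeasure M A + emeasure N A)"
    unfolding countably_additive_def
  proof (intro allI impI)
    fix F :: "nat \<Rightarrow> _" assume F: "range F \<subseteq> sets M" "disjoint_family F"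
    have "(\<Sum>i. emeasure M (F i) + emeasure N (F i)) = (\<Sum>i. emeasure M (F i)) + (\<Sum>i. emeasure N (F i))"
      by (rule suminf_add[symmetric]) auto
    then show "(\<Sum>i. emeasure M (F i) + emeasure N (F i)) = emeasure M (\<Union> (range F)) + emeasure N (\<Union> (range F))"
      using F assms by (simp add: suminf_emeasure)
  qed
  then show ?thesis
    unfolding add_measure_def using assms(2)
    by (intro emeasure_measure_of_sigma sets.sigma_algebra_axioms) (simp_all add: positive_def)
qed

lemma nn_integral_add_measure:
  assumes "sets M = sets N" and f: "f \<in> borel_measurable M"
  shows "(\<integral>\<^sup>+ x. f x \<partial>add_measure M N) = (\<integral>\<^sup>+ x. f x \<partial>M) + (\<integral>\<^sup>+ x. f x \<partial>N)"
  using f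
proof (induction rule: borel_measurable_induct)
  case (cong f g)
  have "space M = space N" by (rule sets_eq_imp_space_eq) fact
  then have "(\<integral>\<^sup>+ x. f x \<partial>add_measure M N) = (\<integral>\<^sup>+ x. g x \<partial>add_measure M N)"
    "(\<integral>\<^sup>+ x. f x \<partial>M) = (\<integral>\<^sup>+ x. g x \<partial>M)" "(\<integral>\<^sup>+ x. f x \<partial>N) = (\<integral>\<^sup>+ x. g x \<partial>N)"
    using cong(3) by (auto intro!: nn_integral_cong)
  with cong show ?case by simp
next
  case (set A)
  with assms(1) show ?case by (simp add: emeasure_add_measure)
next
  case (mult u c)
  have "u \<in> borel_measurable N" "u \<in> borel_measurable (add_measure M N)"
    using mult(2) measurable_cong_sets[OF assms(1) refl] by (auto cong: measurable_cong_sets)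
  with mult show ?case by (simp add: nn_integral_cmult distrib_left)
next
  case (add u v)
  have "u \<in> borel_measurable N" "u \<in> borel_measurable (add_measure M N)"
    "v \<in> borel_measurable N" "v \<in> borel_measurable (add_measure M N)"
    using add(1,3) measurable_cong_sets[OF assms(1) refl, of borel]
      measurable_cong_sets[OF sets_add_measure refl, of M N borel] by blast+
  with add show ?case by (simp add: nn_integral_add ac_simps)
next
  case (seq U)
  have m: "U i \<in> borel_measurable N" "U i \<in> borel_measurable (add_measure M N)" for i
    using seq(1)[of i] measurable_cong_sets[OF assms(1) refl] by (auto cong: measurable_cong_sets)
  have mono: "incseq (\<lambda>i. \<integral>\<^sup>+x. U i x \<partial>L)" for L
    using \<open>incseq U\<close> by (auto simp: incseq_def le_fun_def intro!: nn_integral_mono)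
  have *: "(\<integral>\<^sup>+ x. Sup (range U) x \<partial>L) = (SUP i. \<integral>\<^sup>+x. U i x \<partial>L)"
    if "\<And>i. U i \<in> borel_measurable L" for L
    using nn_integral_monotone_convergence_SUP[OF \<open>incseq U\<close> that] by (simp add: SUP_apply image_comp)
  show ?case
    by (simp only: *[OF seq(1)] *[OF m(1)] *[OF m(2)] seq.IH ennreal_SUP_add[OF mono mono])
qed

lemma closed_supp: "closed (supp M)"
proof -
  have "- supp M = \<Union>{U. open U \<and> emeasure M U = 0}"
    by (auto simp: supp_def zero_less_iff_neq_zero)
  then show ?thesis by (metis (no_types, lifting) closed_def mem_Collect_eq open_Union)
qed

text \<open>The complement is a union of open null sets, possibly uncountably many; by Lindelof
  countably many of them already cover it.\<close>

lemma emeasure_Compl_supp: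
  fixes M :: "'a::second_countable_topology measure"
  assumes "sets M = sets borel"
  shows "emeasure M (- supp M) = 0"
proof -
  let ?F = "{U. open U \<and> emeasure M U = 0}"
  obtain F' where F': "F' \<subseteq> ?F" "countable F'" "\<Union>F' = \<Union>?F"
    using Lindelof[of ?F] by auto
  have "\<Union>F' \<in> null_sets M"
    using null_sets_UN'[of F' "\<lambda>U. U" M] F'(1,2) assms unfolding null_sets_def by force
  moreover have "\<Union>?F = - supp M"
    by (auto simp: supp_def zero_less_iff_neq_zero)
  ultimately show ?thesis using F'(3) by (auto simp: null_sets_def)
qed

section \<open>Transport plans with a catalyst\<close>

text \<open>The catalyst \<open>\<Theta>\<close> is a part of \<open>C \<mu>\<close> that takes part in the transport but is restored in
  the end. Since only \<open>\<epsilon> \<Theta>\<close> with small \<open>\<epsilon>\<close> is used, the constant \<open>C\<close> is irrelevant.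
  The marginals are set functions on Borel sets so that finite sums can be written pointwise.\<close>

definition catalytic_witness ::
  "real \<Rightarrow> 'a::euclidean_space set \<Rightarrow> 'a measure \<Rightarrow> ('a set \<Rightarrow> ennreal) \<Rightarrow> ('a set \<Rightarrow> ennreal) \<Rightarrow> ennreal
    \<Rightarrow> ('a \<times> 'a) measure \<Rightarrow> 'a measure \<Rightarrow> real \<Rightarrow> bool"
  where "catalytic_witness p \<Omega> \<mu> \<alpha> \<beta> c \<pi> \<Theta> C \<longleftrightarrow>
    sets \<pi> = sets borel \<and> emeasure \<pi> (UNIV - \<Omega> \<times> \<Omega>) = 0
    \<and> sets \<Theta> = sets borel \<and> (\<forall>A\<in>sets borel. emeasure \<Theta> A \<le> ennreal C * emeasure \<mu> A)
    \<and> (\<forall>A\<in>sets borel. emeasure \<pi> (A \<times> UNIV) = \<alpha> A + emeasure \<Theta> A)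
    \<and> (\<forall>A\<in>sets borel. emeasure \<pi> (UNIV \<times> A) = \<beta> A + emeasure \<Theta> A)
    \<and> (\<integral>\<^sup>+ z. ennreal (dist (fst z) (snd z) powr p) \<partial>\<pi>) \<le> c"

definition catalytic_plan ::
  "real \<Rightarrow> 'a::euclidean_space set \<Rightarrow> 'a measure \<Rightarrow> ('a set \<Rightarrow> ennreal) \<Rightarrow> ('a set \<Rightarrow> ennreal) \<Rightarrow> ennreal \<Rightarrow> bool"
  where "catalytic_plan p \<Omega> \<mu> \<alpha> \<beta> c \<longleftrightarrow> (\<exists>\<pi> \<Theta> C. catalytic_witness p \<Omega> \<mu> \<alpha> \<beta> c \<pi> \<Theta> C)"

lemma borel_measurable_dist_powr [measurable]:
  "(\<lambda>z. ennreal (dist (fst z) (snd z) powr p)) \<in> borel_measurable (borel :: ('a::euclidean_space \<times> 'a) measure)"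
  unfolding borel_prod[symmetric] by measurable

lemma nn_integral_dist_powr_distr:
  assumes "T \<in> measurable M (borel :: ('a::euclidean_space \<times> 'a) measure)"
  shows "(\<integral>\<^sup>+ z. ennreal (dist (fst z) (snd z) powr p) \<partial>distr M borel T)
    = (\<integral>\<^sup>+ x. ennreal (dist (fst (T x)) (snd (T x)) powr p) \<partial>M)"
  by (rule nn_integral_distr[OF assms]) (simp only: measurable_distr_eq1 borel_measurable_dist_powr)

lemma borel_Times_UNIV [measurable, simp]:
  fixes A :: "'a::euclidean_space set"
  assumes "A \<in> sets borel"
  shows "A \<times> (UNIV :: 'a set) \<in> sets borel" "(UNIV :: 'a set) \<times> A \<in> sets borel"
  using assms by (auto simp: borel_prod[symmetric])

context
  fixes p :: real and \<Omega> :: "'a::euclidean_space set" and \<mu> :: "'a measure"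
begin

lemma catalytic_planI:
  assumes "sets \<pi> = sets borel" "emeasure \<pi> (UNIV - \<Omega> \<times> \<Omega>) = 0" "sets \<Theta> = sets borel"
    "\<And>A. A \<in> sets borel \<Longrightarrow> emeasure \<Theta> A \<le> ennreal C * emeasure \<mu> A"
    "\<And>A. A \<in> sets borel \<Longrightarrow> emeasure \<pi> (A \<times> UNIV) = \<alpha> A + emeasure \<Theta> A"
    "\<And>A. A \<in> sets borel \<Longrightarrow> emeasure \<pi> (UNIV \<times> A) = \<beta> A + emeasure \<Theta> A"
    "(\<integral>\<^sup>+ z. ennreal (dist (fst z) (snd z) powr p) \<partial>\<pi>) \<le> c"
  shows "catalytic_plan p \<Omega> \<mu> \<alpha> \<beta> c"
  unfolding catalytic_plan_def catalytic_witness_def using assms by blast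

lemma catalytic_witnessD:
  assumes "catalytic_witness p \<Omega> \<mu> \<alpha> \<beta> c \<pi> \<Theta> C"
  shows "sets \<pi> = sets borel" "emeasure \<pi> (UNIV - \<Omega> \<times> \<Omega>) = 0" "sets \<Theta> = sets borel"
    "\<And>A. A \<in> sets borel \<Longrightarrow> emeasure \<Theta> A \<le> ennreal C * emeasure \<mu> A"
    "\<And>A. A \<in> sets borel \<Longrightarrow> emeasure \<pi> (A \<times> UNIV) = \<alpha> A + emeasure \<Theta> A"
    "\<And>A. A \<in> sets borel \<Longrightarrow> emeasure \<pi> (UNIV \<times> A) = \<beta> A + emeasure \<Theta> A"
    "(\<integral>\<^sup>+ z. ennreal (dist (fst z) (snd z) powr p) \<partial>\<pi>) \<le> c"
  using assms unfolding catalytic_witness_def by blast+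

text \<open>\<open>C\<close> may always be enlarged. Positivity lets \<open>ennreal\<close>
  distribute over sums and products of such constants, and makes \<open>1 / C\<close> a usable
  threshold for \<epsilon>.\<close>

lemma catalytic_planE:
  assumes "catalytic_plan p \<Omega> \<mu> \<alpha> \<beta> c"
  obtains \<pi> \<Theta> C where "catalytic_witness p \<Omega> \<mu> \<alpha> \<beta> c \<pi> \<Theta> C" "C > 0"
proof -
  from assms obtain \<pi> \<Theta> C where w: "catalytic_witness p \<Omega> \<mu> \<alpha> \<beta> c \<pi> \<Theta> C"
    unfolding catalytic_plan_def by blast
  have "emeasure \<Theta> A \<le> ennreal (max C 1) * emeasure \<mu> A" if "A \<in> sets borel" for A
    by (rule order_trans[OF catalytic_witnessD(4)[OF w that]]) (intro mult_right_mono ennreal_leI, auto)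
  with w have "catalytic_witness p \<Omega> \<mu> \<alpha> \<beta> c \<pi> \<Theta> (max C 1)"
    unfolding catalytic_witness_def by blast
  then show ?thesis using that[of \<pi> \<Theta> "max C 1"] by force
qed

lemma catalytic_plan_mono:
  assumes "catalytic_plan p \<Omega> \<mu> \<alpha> \<beta> c" "c \<le> c'"
    "\<And>A. A \<in> sets borel \<Longrightarrow> \<alpha>' A = \<alpha> A" "\<And>A. A \<in> sets borel \<Longrightarrow> \<beta>' A = \<beta> A"
  shows "catalytic_plan p \<Omega> \<mu> \<alpha>' \<beta>' c'"
proof -
  from assms(1) obtain \<pi> \<Theta> C where w: "catalytic_witness p \<Omega> \<mu> \<alpha> \<beta> c \<pi> \<Theta> C"
    unfolding catalytic_plan_def by blast
  note * = catalytic_witnessD[OF w]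
  show ?thesis
    by (rule catalytic_planI[of \<pi> \<Theta> C]) (use * assms(2-) in auto)
qed

lemma catalytic_plan_zero: "catalytic_plan p \<Omega> \<mu> (\<lambda>A. 0) (\<lambda>A. 0) c"
  by (rule catalytic_planI[of "null_measure borel" "null_measure borel" 0]) auto

lemma catalytic_plan_add:
  assumes "catalytic_plan p \<Omega> \<mu> \<alpha> \<beta> c" "catalytic_plan p \<Omega> \<mu> \<alpha>' \<beta>' c'"
  shows "catalytic_plan p \<Omega> \<mu> (\<lambda>A. \<alpha> A + \<alpha>' A) (\<lambda>A. \<beta> A + \<beta>' A) (c + c')"
proof -
  from assms(1) obtain \<pi> \<Theta> C where w1: "catalytic_witness p \<Omega> \<mu> \<alpha> \<beta> c \<pi> \<Theta> C" "C > 0"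
    by (rule catalytic_planE)
  note 1 = catalytic_witnessD[OF w1(1)] w1(2)
  from assms(2) obtain \<pi>' \<Theta>' C' where w2: "catalytic_witness p \<Omega> \<mu> \<alpha>' \<beta>' c' \<pi>' \<Theta>' C'" "C' > 0"
    by (rule catalytic_planE)
  note 2 = catalytic_witnessD[OF w2(1)] w2(2)
  have f: "(\<lambda>z. ennreal (dist (fst z) (snd z) powr p)) \<in> borel_measurable \<pi>"
    using borel_measurable_dist_powr measurable_cong_sets[OF 1(1) refl] by blast
  \<comment> \<open>This is wanted for every set: \<Omega> is arbitrary in this context, so
    \<open>UNIV - \<Omega> \<times> \<Omega>\<close> need not be Borel. On non-measurable sets all
    three values are 0 by convention.\<close>
  have e: "emeasure (add_measure \<pi> \<pi>') A = emeasure \<pi> A + emeasure \<pi>' A" for A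
    using 1(1) 2(1) emeasure_notin_sets[of A \<pi>] emeasure_notin_sets[of A \<pi>'] emeasure_notin_sets[of A "add_measure \<pi> \<pi>'"]
    by (cases "A \<in> sets \<pi>") (auto simp: emeasure_add_measure)
  have t: "emeasure (add_measure \<Theta> \<Theta>') A = emeasure \<Theta> A + emeasure \<Theta>' A" if "A \<in> sets borel" for A
    using that 1(3) 2(3) by (auto simp: emeasure_add_measure)
  show ?thesis
  proof (rule catalytic_planI[of "add_measure \<pi> \<pi>'" "add_measure \<Theta> \<Theta>'" "C + C'"])
    show "emeasure (add_measure \<Theta> \<Theta>') A \<le> ennreal (C + C') * emeasure \<mu> A" if "A \<in> sets borel" for A
      using add_mono[OF 1(4)[OF that] 2(4)[OF that]] 1(8) 2(8) by (simp add: t[OF that] distrib_right)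
    show "(\<integral>\<^sup>+ z. ennreal (dist (fst z) (snd z) powr p) \<partial>add_measure \<pi> \<pi>') \<le> c + c'"
      using 1 2 f by (subst nn_integral_add_measure) (auto intro: add_mono)
  qed (use 1 2 in \<open>auto simp: e t ac_simps\<close>)
qed

lemma catalytic_plan_scale:
  assumes "catalytic_plan p \<Omega> \<mu> \<alpha> \<beta> c" "r < \<infinity>"
  shows "catalytic_plan p \<Omega> \<mu> (\<lambda>A. r * \<alpha> A) (\<lambda>A. r * \<beta> A) (r * c)"
proof -
  from assms(1) obtain \<pi> \<Theta> C where w1: "catalytic_witness p \<Omega> \<mu> \<alpha> \<beta> c \<pi> \<Theta> C" "C > 0"
    by (rule catalytic_planE)
  note 1 = catalytic_witnessD[OF w1(1)] w1(2)
  obtain r' where r: "r = ennreal r'" "r' \<ge> 0" using assms(2) by (cases r) auto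
  have f: "(\<lambda>z. ennreal (dist (fst z) (snd z) powr p)) \<in> borel_measurable \<pi>"
    using borel_measurable_dist_powr measurable_cong_sets[OF 1(1) refl] by blast
  show ?thesis
  proof (rule catalytic_planI[of "scale_measure r \<pi>" "scale_measure r \<Theta>" "r' * C"])
    show "emeasure (scale_measure r \<Theta>) A \<le> ennreal (r' * C) * emeasure \<mu> A" if "A \<in> sets borel" for A
      using mult_left_mono[OF 1(4)[OF that], of r] r 1(8) by (simp add: ennreal_mult mult.assoc)
    show "(\<integral>\<^sup>+ z. ennreal (dist (fst z) (snd z) powr p) \<partial>scale_measure r \<pi>) \<le> r * c"
      using 1(7) f by (simp add: nn_integral_scale_measure mult_left_mono)
  qed (use 1 in \<open>auto simp: distrib_left\<close>)
qed

lemma catalytic_plan_sum: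
  assumes "finite I" "\<And>i. i \<in> I \<Longrightarrow> catalytic_plan p \<Omega> \<mu> (\<alpha> i) (\<beta> i) (c i)"
  shows "catalytic_plan p \<Omega> \<mu> (\<lambda>A. \<Sum>i\<in>I. \<alpha> i A) (\<lambda>A. \<Sum>i\<in>I. \<beta> i A) (\<Sum>i\<in>I. c i)"
  using assms by (induction I) (simp_all add: catalytic_plan_zero catalytic_plan_add)

text \<open>The plan itself stays the same; the common part \<theta> of its marginals is merely
  booked as catalyst. This is the substitute for gluing two plans along \<theta>.\<close>

lemma catalytic_plan_cancel:
  assumes "catalytic_plan p \<Omega> \<mu> (\<lambda>A. \<alpha> A + emeasure \<theta> A) (\<lambda>A. \<beta> A + emeasure \<theta> A) c"
    and \<theta>: "sets \<theta> = sets borel" "\<And>A. A \<in> sets borel \<Longrightarrow> emeasure \<theta> A \<le> ennreal C' * emeasure \<mu> A" "C' \<ge> 0"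
  shows "catalytic_plan p \<Omega> \<mu> \<alpha> \<beta> c"
proof -
  from assms(1) obtain \<pi> \<Theta> C where w1: "catalytic_witness p \<Omega> \<mu> (\<lambda>A. \<alpha> A + emeasure \<theta> A) (\<lambda>A. \<beta> A + emeasure \<theta> A) c \<pi> \<Theta> C" "C > 0"
    by (rule catalytic_planE)
  note 1 = catalytic_witnessD[OF w1(1)] w1(2)
  have t: "emeasure (add_measure \<theta> \<Theta>) A = emeasure \<theta> A + emeasure \<Theta> A" if "A \<in> sets borel" for A
    using that 1(3) \<theta>(1) by (auto simp: emeasure_add_measure)
  show ?thesis
  proof (rule catalytic_planI[of \<pi> "add_measure \<theta> \<Theta>" "C' + C"])
    show "emeasure (add_measure \<theta> \<Theta>) A \<le> ennreal (C' + C) * emeasure \<mu> A" if "A \<in> sets borel" for A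
      using add_mono[OF \<theta>(2)[OF that] 1(4)[OF that]] 1(8) \<theta>(3) by (simp add: t[OF that] distrib_right)
  qed (use 1 \<theta> in \<open>auto simp: t ac_simps\<close>)
qed

lemma catalytic_plan_cancel_sum:
  assumes "finite I"
    and "catalytic_plan p \<Omega> \<mu> (\<lambda>A. \<alpha> A + (\<Sum>i\<in>I. t i * emeasure (\<theta> i) A)) (\<lambda>A. \<beta> A + (\<Sum>i\<in>I. t i * emeasure (\<theta> i) A)) c"
    and "\<And>i. i \<in> I \<Longrightarrow> t i < \<infinity>"
    and "\<And>i. i \<in> I \<Longrightarrow> sets (\<theta> i) = sets borel \<and> (\<exists>C\<ge>0. \<forall>A\<in>sets borel. emeasure (\<theta> i) A \<le> ennreal C * emeasure \<mu> A)"
  shows "catalytic_plan p \<Omega> \<mu> \<alpha> \<beta> c"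
  using assms
proof (induction I)
  case empty
  then show ?case by simp
next
  case (insert i I)
  from insert.prems(3)[of i] obtain C where C: "sets (\<theta> i) = sets borel" "C \<ge> 0"
    "\<forall>A\<in>sets borel. emeasure (\<theta> i) A \<le> ennreal C * emeasure \<mu> A" by auto
  obtain r where r: "t i = ennreal r" "r \<ge> 0" using insert.prems(2)[of i] by (cases "t i") auto
  have "catalytic_plan p \<Omega> \<mu> (\<lambda>A. \<alpha> A + (\<Sum>i\<in>I. t i * emeasure (\<theta> i) A)) (\<lambda>A. \<beta> A + (\<Sum>i\<in>I. t i * emeasure (\<theta> i) A)) c"
  proof (rule catalytic_plan_cancel[where \<theta> = "scale_measure (t i) (\<theta> i)" and C' = "r * C"])
    show "emeasure (scale_measure (t i) (\<theta> i)) A \<le> ennreal (r * C) * emeasure \<mu> A" if "A \<in> sets borel" for A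
      using mult_left_mono[of "emeasure (\<theta> i) A" "ennreal C * emeasure \<mu> A" "t i"] C r that by (simp add: ennreal_mult mult.assoc)
  qed (use insert C r in \<open>auto simp: ac_simps\<close>)
  then show ?case using insert by auto
qed

text \<open>Reverses a plan, so that the result on gathering a measure into a blob also spreads a
  blob out over \<open>\<nu>m\<close>.\<close>

lemma catalytic_plan_swap:
  assumes "catalytic_plan p \<Omega> \<mu> \<alpha> \<beta> c"
  shows "catalytic_plan p \<Omega> \<mu> \<beta> \<alpha> c"
proof -
  from assms(1) obtain \<pi> \<Theta> C where w1: "catalytic_witness p \<Omega> \<mu> \<alpha> \<beta> c \<pi> \<Theta> C" "C > 0"
    by (rule catalytic_planE)
  note 1 = catalytic_witnessD[OF w1(1)] w1(2)
  have sw: "prod.swap \<in> measurable \<pi> (borel :: ('a \<times> 'a) measure)"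
    unfolding prod.swap_def measurable_cong_sets[OF 1(1) refl]
    by (auto intro!: borel_measurable_continuous_onI continuous_intros)
  have sp: "space \<pi> = UNIV" using sets_eq_imp_space_eq[OF 1(1)] by simp
  have e: "emeasure (distr \<pi> borel prod.swap) A = emeasure \<pi> (prod.swap -` A)" for A
  proof (cases "A \<in> sets borel")
    case True
    then show ?thesis using sw sp by (simp add: emeasure_distr)
  next
    \<comment> \<open>The swap is its own inverse, so a measurable preimage would make
      \<open>A\<close> measurable. Again both sides are then 0 by convention.\<close>
    case False
    have "prod.swap -` A \<notin> sets \<pi>"
    proof
      assume "prod.swap -` A \<in> sets \<pi>"
      moreover have "prod.swap \<in> measurable (borel :: ('a \<times> 'a) measure) \<pi>"
        using sw measurable_cong_sets[OF 1(1) refl] measurable_cong_sets[OF refl 1(1)] by blast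
      ultimately have "prod.swap -` (prod.swap -` A) \<inter> space borel \<in> sets (borel :: ('a \<times> 'a) measure)"
        by (rule measurable_sets[rotated])
      with False show False by (simp add: vimage_comp)
    qed
    with False show ?thesis by (simp add: emeasure_notin_sets)
  qed
  have v: "prod.swap -` (A \<times> B) = B \<times> A" for A B :: "'a set" by auto
  have v': "prod.swap -` (UNIV - A \<times> B) = UNIV - B \<times> A" for A B :: "'a set" by auto
  show ?thesis
  proof (rule catalytic_planI[of "distr \<pi> borel prod.swap" \<Theta> C])
    show "(\<integral>\<^sup>+ z. ennreal (dist (fst z) (snd z) powr p) \<partial>distr \<pi> borel prod.swap) \<le> c"
      using 1(7) by (subst nn_integral_dist_powr_distr[OF sw]) (simp add: dist_commute)
  qed (use 1 in \<open>auto simp: e v v'\<close>)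
qed

end

text \<open>The independent coupling is good enough: for measures on two small balls, all pairs of
  points are about equally far apart. The catalyst is zero.\<close>

lemma catalytic_plan_product:
  fixes \<theta>0 \<theta>1 :: "'a::euclidean_space measure"
  assumes \<theta>: "prob_space \<theta>0" "prob_space \<theta>1" "sets \<theta>0 = sets borel" "sets \<theta>1 = sets borel"
    and S: "S \<in> sets borel" "S \<subseteq> \<Omega>" "emeasure \<theta>0 (UNIV - S) = 0"
    and T: "T \<in> sets borel" "T \<subseteq> \<Omega>" "emeasure \<theta>1 (UNIV - T) = 0"
    and r: "\<And>x y. x \<in> S \<Longrightarrow> y \<in> T \<Longrightarrow> dist x y \<le> r" and p: "0 \<le> p"
  shows "catalytic_plan p \<Omega> \<mu> (emeasure \<theta>0) (emeasure \<theta>1) (ennreal (r powr p))"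
proof -
  interpret t0: prob_space \<theta>0 by fact
  interpret t1: prob_space \<theta>1 by fact
  interpret pair_prob_space \<theta>0 \<theta>1 ..
  let ?P = "\<theta>0 \<Otimes>\<^sub>M \<theta>1"
  have sp: "space \<theta>0 = UNIV" "space \<theta>1 = UNIV" using \<theta>(3,4)[THEN sets_eq_imp_space_eq] by auto
  have sets: "sets ?P = sets (borel :: ('a \<times> 'a) measure)"
    unfolding borel_prod[symmetric] by (intro sets_pair_measure_cong \<theta>)
  have times: "emeasure ?P (A \<times> B) = emeasure \<theta>0 A * emeasure \<theta>1 B" if "A \<in> sets borel" "B \<in> sets borel" for A B
    using that \<theta> by (intro t1.emeasure_pair_measure_Times) auto
  have one: "emeasure \<theta>0 UNIV = 1" "emeasure \<theta>1 UNIV = 1"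
    using t0.emeasure_space_1 t1.emeasure_space_1 sp by auto
  have null: "UNIV - S \<times> T \<in> null_sets ?P"
  proof -
    have 1: "(UNIV - S) \<times> UNIV \<in> null_sets ?P" "UNIV \<times> (UNIV - T) \<in> null_sets ?P"
      using times[of "UNIV - S" UNIV] times[of UNIV "UNIV - T"] S T sets by (auto simp: null_sets_def)
    have "UNIV - S \<times> T \<in> sets (borel \<Otimes>\<^sub>M borel)"
      using sets.compl_sets[OF pair_measureI[OF S(1) T(1)]] by (simp add: space_pair_measure)
    then have 2: "UNIV - S \<times> T \<in> sets ?P" unfolding sets borel_prod .
    show ?thesis by (rule null_sets_subset[OF null_sets.Un[OF 1] 2]) auto
  qed
  have "emeasure ?P (UNIV - \<Omega> \<times> \<Omega>) = 0"
  proof (cases "UNIV - \<Omega> \<times> \<Omega> \<in> sets ?P")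
    case True
    then show ?thesis using null_sets_subset[OF null True] S T by (auto simp: null_sets_def)
  qed (simp add: emeasure_notin_sets)
  moreover have "(\<integral>\<^sup>+ z. ennreal (dist (fst z) (snd z) powr p) \<partial>?P) \<le> (\<integral>\<^sup>+ z. ennreal (r powr p) \<partial>?P)"
  proof (rule nn_integral_mono_AE)
    show "AE z in ?P. ennreal (dist (fst z) (snd z) powr p) \<le> ennreal (r powr p)"
    proof (rule AE_I'[OF null], rule subsetI)
      fix z assume z: "z \<in> {z \<in> space ?P. \<not> ennreal (dist (fst z) (snd z) powr p) \<le> ennreal (r powr p)}"
      have "dist (fst z) (snd z) powr p \<le> r powr p" if "z \<in> S \<times> T"
        using that r p by (intro powr_mono2) (auto simp: mem_Times_iff)
      with z show "z \<in> UNIV - S \<times> T" by (auto intro: ennreal_leI)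
    qed
  qed
  ultimately show ?thesis
    using times one sets by (intro catalytic_planI[of ?P _ "null_measure borel" 0])
      (auto simp: emeasure_space_1)
qed

text \<open>For \<epsilon> < 1 / C the measure \<epsilon> \<Theta> can be taken out of \<mu>. The
  coupling is \<epsilon> \<pi> plus the rest of \<mu> placed on the diagonal, where it costs
  nothing; the two contributions of \<epsilon> \<Theta> cancel in both marginals.\<close>

lemma catalytic_plan_imp_cost_bound:
  fixes \<mu> :: "'a::euclidean_space measure"
  assumes plan: "catalytic_plan p \<Omega> \<mu> (emeasure \<nu>p) (emeasure \<nu>m) c"
    and \<mu>: "finite_measure \<mu>" "sets \<mu> = sets borel" "emeasure \<mu> (UNIV - \<Omega>) = 0"
    and \<Omega>: "closed \<Omega>" and \<nu>: "sets \<nu>p = sets borel" "sets \<nu>m = sets borel"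
  shows "\<forall>\<^sub>F \<epsilon> in at_right 0.
    (INF \<pi>\<in>couplings \<Omega> (add_measure \<mu> (scale_measure (ennreal \<epsilon>) \<nu>p)) (add_measure \<mu> (scale_measure (ennreal \<epsilon>) \<nu>m)).
      \<integral>\<^sup>+ z. ennreal (dist (fst z) (snd z) powr p) \<partial>\<pi>) \<le> ennreal \<epsilon> * c"
proof -
  from plan obtain \<pi> \<Theta> C where w: "catalytic_witness p \<Omega> \<mu> (emeasure \<nu>p) (emeasure \<nu>m) c \<pi> \<Theta> C" "C > 0"
    by (rule catalytic_planE)
  note 1 = catalytic_witnessD[OF w(1)]
  interpret finite_measure \<mu> by fact
  have "\<forall>\<^sub>F \<epsilon> in at_right 0. 0 < \<epsilon> \<and> \<epsilon> < 1 / C"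
    using w(2) by (intro eventually_at_rightI[of 0 "1 / C"]) auto
  then show ?thesis
  proof (rule eventually_mono)
    fix \<epsilon> :: real assume e: "0 < \<epsilon> \<and> \<epsilon> < 1 / C"
    let ?e = "ennreal \<epsilon>" and ?D = "diff_measure \<mu> (scale_measure (ennreal \<epsilon>) \<Theta>)"
    have le: "?e * emeasure \<Theta> A \<le> emeasure \<mu> A" if "A \<in> sets borel" for A
    proof -
      have "?e * emeasure \<Theta> A \<le> ?e * (ennreal C * emeasure \<mu> A)"
        using 1(4)[OF that] by (rule mult_left_mono) simp
      also have "\<dots> = ennreal (\<epsilon> * C) * emeasure \<mu> A" using e w(2) by (simp add: ennreal_mult mult.assoc)
      also have "\<dots> \<le> ennreal 1 * emeasure \<mu> A"
        using e w(2) by (intro mult_right_mono ennreal_leI) (auto simp: field_simps)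
      finally show ?thesis by simp
    qed
    have spT: "space \<Theta> = UNIV" "space \<mu> = UNIV" "space \<pi> = UNIV"
      using sets_eq_imp_space_eq[OF 1(3)] sets_eq_imp_space_eq[OF \<mu>(2)] sets_eq_imp_space_eq[OF 1(1)] by simp_all
    have "?e * emeasure \<Theta> UNIV \<noteq> \<infinity>"
      using le[of UNIV] emeasure_finite[of UNIV] by (auto simp: top_unique)
    then have finT: "finite_measure (scale_measure ?e \<Theta>)"
      by (intro finite_measureI) (simp add: space_scale_measure spT)
    have D: "emeasure ?D A = emeasure \<mu> A - ?e * emeasure \<Theta> A" if "A \<in> sets borel" for A
      using le that \<mu> 1(3) finT
      by (subst emeasure_diff_measure) (auto intro: finite_measure_axioms)
    have setsD: "sets ?D = sets borel" using \<mu> by simp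
    have diag: "(\<lambda>x. (x, x)) \<in> measurable ?D (borel :: ('a \<times> 'a) measure)"
      unfolding measurable_cong_sets[OF setsD refl]
      by (auto intro!: borel_measurable_continuous_onI continuous_intros)
    let ?P = "add_measure (scale_measure ?e \<pi>) (distr ?D borel (\<lambda>x. (x, x)))"
    have setsP: "sets ?P = sets borel" using 1(1) by simp
    have P: "emeasure ?P B = ?e * emeasure \<pi> B + emeasure ?D ((\<lambda>x. (x, x)) -` B)" if "B \<in> sets borel" for B
      using that 1(1) diag spT by (subst emeasure_add_measure) (auto simp: emeasure_distr)
    have fs: "fst \<in> measurable ?P (borel :: 'a measure)" "snd \<in> measurable ?P (borel :: 'a measure)"
      unfolding measurable_cong_sets[OF setsP refl]
      by (auto intro!: borel_measurable_continuous_onI continuous_intros)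
    have v: "(\<lambda>x. (x, x)) -` (A \<times> UNIV) = A" "(\<lambda>x. (x, x)) -` (UNIV \<times> A) = A"
      "fst -` A = A \<times> UNIV" "snd -` A = UNIV \<times> A" for A :: "'a set"
      by auto
    \<comment> \<open>Subtraction in \<open>ennreal\<close> is truncated, so the cancellation rests
      on \<open>le\<close>.\<close>
    have marg: "?e * (x + emeasure \<Theta> A) + (emeasure \<mu> A - ?e * emeasure \<Theta> A) = emeasure \<mu> A + ?e * x"
      if "A \<in> sets borel" for A x
    proof -
      have "?e * (x + emeasure \<Theta> A) + (emeasure \<mu> A - ?e * emeasure \<Theta> A)
        = ?e * x + ((emeasure \<mu> A - ?e * emeasure \<Theta> A) + ?e * emeasure \<Theta> A)"
        by (simp add: distrib_left ac_simps)
      then show ?thesis unfolding diff_add_cancel_ennreal[OF le[OF that]] by (simp add: add.commute)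
    qed
    have spP: "space ?P = UNIV" using sets_eq_imp_space_eq[OF setsP] by simp
    have "distr ?P borel fst = add_measure \<mu> (scale_measure ?e \<nu>p)"
    proof (rule measure_eqI)
      fix A assume "A \<in> sets (distr ?P borel fst)"
      then have A: "A \<in> sets borel" by simp
      then show "emeasure (distr ?P borel fst) A = emeasure (add_measure \<mu> (scale_measure ?e \<nu>p)) A"
        using fs spP by (simp add: emeasure_distr emeasure_add_measure \<mu> \<nu> v P D 1(5) marg)
    qed (use \<mu> in simp)
    moreover have "distr ?P borel snd = add_measure \<mu> (scale_measure ?e \<nu>m)"
    proof (rule measure_eqI)
      fix A assume "A \<in> sets (distr ?P borel snd)"
      then have A: "A \<in> sets borel" by simp
      then show "emeasure (distr ?P borel snd) A = emeasure (add_measure \<mu> (scale_measure ?e \<nu>m)) A"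
        using fs spP by (simp add: emeasure_distr emeasure_add_measure \<mu> \<nu> v P D 1(6) marg)
    qed (use \<mu> in simp)
    moreover have "emeasure ?P (UNIV - \<Omega> \<times> \<Omega>) = 0"
    proof -
      have b: "UNIV - \<Omega> \<times> \<Omega> \<in> sets borel" "UNIV - \<Omega> \<in> sets borel"
        using borel_closed[OF closed_Times[OF \<Omega> \<Omega>]] borel_closed[OF \<Omega>] by auto
      have "(\<lambda>x. (x, x)) -` (UNIV - \<Omega> \<times> \<Omega>) = UNIV - \<Omega>" by auto
      then show ?thesis using b by (simp add: P 1(2) D \<mu>)
    qed
    ultimately have "?P \<in> couplings \<Omega> (add_measure \<mu> (scale_measure ?e \<nu>p)) (add_measure \<mu> (scale_measure ?e \<nu>m))"
      using setsP by (simp add: couplings_def)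
    moreover have "(\<integral>\<^sup>+ z. ennreal (dist (fst z) (snd z) powr p) \<partial>?P) \<le> ?e * c"
    proof -
      have f: "(\<lambda>z. ennreal (dist (fst z) (snd z) powr p)) \<in> borel_measurable \<pi>"
        using borel_measurable_dist_powr measurable_cong_sets[OF 1(1) refl] by blast
      then have f': "(\<lambda>z. ennreal (dist (fst z) (snd z) powr p)) \<in> borel_measurable (scale_measure ?e \<pi>)"
        by (simp cong: measurable_cong_sets)
      have "(\<integral>\<^sup>+ z. ennreal (dist (fst z) (snd z) powr p) \<partial>?P)
        = ?e * (\<integral>\<^sup>+ z. ennreal (dist (fst z) (snd z) powr p) \<partial>\<pi>)"
        using f f' 1(1) by (subst nn_integral_add_measure)
          (simp_all add: nn_integral_scale_measure nn_integral_dist_powr_distr[OF diag])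
      then show ?thesis using 1(7) by (simp add: mult_left_mono)
    qed
    ultimately show "(INF \<pi>\<in>couplings \<Omega> (add_measure \<mu> (scale_measure ?e \<nu>p)) (add_measure \<mu> (scale_measure ?e \<nu>m)).
      \<integral>\<^sup>+ z. ennreal (dist (fst z) (snd z) powr p) \<partial>\<pi>) \<le> ?e * c"
      by (rule INF_lower2)
  qed
qed

section \<open>Cost of moving small blobs between two points\<close>

definition concentrated_at :: "'a::euclidean_space set \<Rightarrow> 'a \<Rightarrow> real \<Rightarrow> 'a measure \<Rightarrow> bool" where
  "concentrated_at \<Omega> x r \<theta> \<longleftrightarrow>
    prob_space \<theta> \<and> sets \<theta> = sets borel \<and> emeasure \<theta> (UNIV - \<Omega> \<inter> ball x r) = 0"

definition linked :: "real \<Rightarrow> 'a::euclidean_space set \<Rightarrow> 'a measure \<Rightarrow> 'a \<Rightarrow> 'a \<Rightarrow> real \<Rightarrow> bool" where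
  "linked p \<Omega> \<mu> x y c \<longleftrightarrow> (\<forall>c'>c. \<forall>\<^sub>F r in at_right 0. \<forall>\<theta>0 \<theta>1.
    concentrated_at \<Omega> x r \<theta>0 \<longrightarrow> concentrated_at \<Omega> y r \<theta>1 \<longrightarrow>
    catalytic_plan p \<Omega> \<mu> (emeasure \<theta>0) (emeasure \<theta>1) (ennreal c'))"

lemma concentrated_at_mono:
  assumes "concentrated_at \<Omega> x r \<theta>" "r \<le> r'" "closed \<Omega>"
  shows "concentrated_at \<Omega> x r' \<theta>"
proof -
  have "emeasure \<theta> (UNIV - \<Omega> \<inter> ball x r') \<le> emeasure \<theta> (UNIV - \<Omega> \<inter> ball x r)"
    using assms by (intro emeasure_mono) (auto simp: concentrated_at_def)
  then show ?thesis using assms by (simp add: concentrated_at_def)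
qed

lemma linked_mono: "linked p \<Omega> \<mu> x y c \<Longrightarrow> c \<le> d \<Longrightarrow> linked p \<Omega> \<mu> x y d"
  unfolding linked_def by (meson le_less_trans)

text \<open>Since the definition only speaks of \<open>c' > c\<close>, near-optimal chains suffice
  and no limit of plans has to be formed.\<close>

lemma linked_closure: "(\<And>c'. c < c' \<Longrightarrow> \<exists>d<c'. linked p \<Omega> \<mu> x y d) \<Longrightarrow> linked p \<Omega> \<mu> x y c"
  unfolding linked_def by blast

lemma concentrated_at_uniform_measure:
  fixes M :: "'a::euclidean_space measure"
  assumes "finite_measure M" "sets M = sets borel" "B \<in> sets borel" "B \<subseteq> \<Omega> \<inter> ball x r" "emeasure M B \<noteq> 0" "closed \<Omega>"
  shows "concentrated_at \<Omega> x r (uniform_measure M B)"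
proof -
  interpret finite_measure M by fact
  have "B \<inter> (UNIV - \<Omega> \<inter> ball x r) = {}" using assms(4) by blast
  then show ?thesis
    using assms by (auto simp: concentrated_at_def intro!: prob_space_uniform_measure)
qed

context
  fixes p :: real and \<Omega> :: "'a::euclidean_space set" and \<mu> :: "'a measure"
  assumes p: "1 < p" and \<Omega>: "closed \<Omega>"
    and \<mu>: "finite_measure \<mu>" "sets \<mu> = sets borel" "emeasure \<mu> (UNIV - \<Omega>) = 0"
begin

text \<open>A ball around a point of the support has mass b > 0, and \<mu> restricted to it and
  normalised is at most 1 / b times \<mu>. Blobs of this kind can serve as catalysts.\<close>

lemma blob:
  assumes "x \<in> supp \<mu>" "0 < r"
  obtains \<theta> C where "concentrated_at \<Omega> x r \<theta>" "C \<ge> 0"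
    "\<And>A. A \<in> sets borel \<Longrightarrow> emeasure \<theta> A \<le> ennreal C * emeasure \<mu> A"
proof -
  interpret finite_measure \<mu> by fact
  let ?B = "\<Omega> \<inter> ball x r"
  have B: "?B \<in> sets borel" using \<Omega> by auto
  have "0 < emeasure \<mu> (ball x r)" using assms by (auto simp: supp_def)
  also have "\<dots> \<le> emeasure \<mu> (?B \<union> (UNIV - \<Omega>))" using \<Omega> \<mu>(2) by (intro emeasure_mono) auto
  also have "\<dots> \<le> emeasure \<mu> ?B + emeasure \<mu> (UNIV - \<Omega>)" using \<Omega> \<mu>(2) by (intro emeasure_subadditive) auto
  finally have pos: "0 < emeasure \<mu> ?B" using \<mu>(3) by simp
  then obtain b where b: "emeasure \<mu> ?B = ennreal b" "b > 0"
    using emeasure_eq_measure[of ?B] by auto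
  have "emeasure (uniform_measure \<mu> ?B) A \<le> ennreal (1 / b) * emeasure \<mu> A" if "A \<in> sets borel" for A
  proof -
    have "emeasure (uniform_measure \<mu> ?B) A = emeasure \<mu> (?B \<inter> A) / ennreal b"
      using that B \<mu>(2) b by simp
    also have "\<dots> \<le> emeasure \<mu> A / ennreal b"
      using that \<mu>(2) by (intro divide_right_mono_ennreal emeasure_mono) auto
    also have "\<dots> = ennreal (1 / b) * emeasure \<mu> A"
      using b by (simp add: divide_ennreal_def inverse_ennreal mult.commute inverse_eq_divide)
    finally show ?thesis .
  qed
  moreover have "concentrated_at \<Omega> x r (uniform_measure \<mu> ?B)"
    using pos by (intro concentrated_at_uniform_measure \<mu> B \<Omega>) auto
  ultimately show ?thesis using b by (intro that[of "uniform_measure \<mu> ?B" "1 / b"]) auto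
qed

text \<open>Points of the two balls are at most \<open>dist x y + 2 * r\<close> apart, and the p-th
  power is continuous as r tends to 0.\<close>

lemma linked_dist: "linked p \<Omega> \<mu> x y (dist x y powr p)"
  unfolding linked_def
proof (intro allI impI)
  fix c' assume c': "dist x y powr p < c'"
  have "((\<lambda>r. (dist x y + 2 * r) powr p) \<longlongrightarrow> (dist x y + 2 * 0) powr p) (at_right 0)"
  \<comment> \<open>For \<open>x = y\<close> the base tends to 0, where convergence of
    \<open>powr\<close> requires a positive exponent and a base that is eventually
    nonnegative.\<close>
  proof (rule tendsto_powr')
    show "((\<lambda>r. dist x y + 2 * r) \<longlongrightarrow> dist x y + 2 * 0) (at_right 0)"
      by (intro tendsto_intros)
    have "\<forall>\<^sub>F r in at_right 0. 0 \<le> dist x y + 2 * r"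
      using eventually_at_right_less[of "0::real"] by eventually_elim auto
    then show "dist x y + 2 * 0 \<noteq> 0 \<or> 0 < p \<and> (\<forall>\<^sub>F r in at_right 0. 0 \<le> dist x y + 2 * r)"
      using p by simp
  qed simp
  then have "\<forall>\<^sub>F r in at_right 0. (dist x y + 2 * r) powr p < c'"
    using c' by (intro order_tendstoD(2)) auto
  then show "\<forall>\<^sub>F r in at_right 0. \<forall>\<theta>0 \<theta>1.
    concentrated_at \<Omega> x r \<theta>0 \<longrightarrow> concentrated_at \<Omega> y r \<theta>1 \<longrightarrow>
    catalytic_plan p \<Omega> \<mu> (emeasure \<theta>0) (emeasure \<theta>1) (ennreal c')"
  proof (rule eventually_mono, intro allI impI)
    fix r \<theta>0 \<theta>1
    assume r: "(dist x y + 2 * r) powr p < c'" and \<theta>: "concentrated_at \<Omega> x r \<theta>0" "concentrated_at \<Omega> y r \<theta>1"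
    have "catalytic_plan p \<Omega> \<mu> (emeasure \<theta>0) (emeasure \<theta>1) (ennreal ((dist x y + 2 * r) powr p))"
    proof (rule catalytic_plan_product)
      fix u v assume "u \<in> \<Omega> \<inter> ball x r" "v \<in> \<Omega> \<inter> ball y r"
      then have "dist x u < r" "dist y v < r" by auto
      then show "dist u v \<le> dist x y + 2 * r"
        using dist_triangle[of u v x] dist_triangle[of x v y] by (simp add: dist_commute)
    qed (use \<theta> p \<Omega> in \<open>auto simp: concentrated_at_def\<close>)
    then show "catalytic_plan p \<Omega> \<mu> (emeasure \<theta>0) (emeasure \<theta>1) (ennreal c')"
      by (rule catalytic_plan_mono) (use r in \<open>auto intro: ennreal_leI\<close>)
  qed
qed

lemma linked_refl: "linked p \<Omega> \<mu> x x 0"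
  using linked_dist[of x x] by simp

text \<open>A blob at \<open>y\<close> dominated by a multiple of \<mu> is the target of the first
  plan and the source of the second. It appears in both marginals of the sum and is cancelled, which
  leaves the plain sum of the costs.\<close>

lemma linked_trans:
  assumes xy: "linked p \<Omega> \<mu> x y c" and yz: "linked p \<Omega> \<mu> y z d" and y: "y \<in> supp \<mu>"
    and c: "0 \<le> c" "0 \<le> d"
  shows "linked p \<Omega> \<mu> x z (c + d)"
  unfolding linked_def
proof (intro allI impI)
  fix c' assume c': "c + d < c'"
  \<comment> \<open>Half of the available slack for each link.\<close>
  define e where "e = (c' - c - d) / 2"
  have e: "e > 0" "c' = (c + e) + (d + e)" using c' by (simp_all add: e_def field_simps)
  have "\<forall>\<^sub>F r in at_right 0. \<forall>\<theta>0 \<theta>1. concentrated_at \<Omega> x r \<theta>0 \<longrightarrow> concentrated_at \<Omega> y r \<theta>1 \<longrightarrow>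
      catalytic_plan p \<Omega> \<mu> (emeasure \<theta>0) (emeasure \<theta>1) (ennreal (c + e))"
    using xy e(1) unfolding linked_def by simp
  moreover have "\<forall>\<^sub>F r in at_right 0. \<forall>\<theta>0 \<theta>1. concentrated_at \<Omega> y r \<theta>0 \<longrightarrow> concentrated_at \<Omega> z r \<theta>1 \<longrightarrow>
      catalytic_plan p \<Omega> \<mu> (emeasure \<theta>0) (emeasure \<theta>1) (ennreal (d + e))"
    using yz e(1) unfolding linked_def by simp
  ultimately show "\<forall>\<^sub>F r in at_right 0. \<forall>\<theta>0 \<theta>1.
    concentrated_at \<Omega> x r \<theta>0 \<longrightarrow> concentrated_at \<Omega> z r \<theta>1 \<longrightarrow>
    catalytic_plan p \<Omega> \<mu> (emeasure \<theta>0) (emeasure \<theta>1) (ennreal c')"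
    using eventually_at_right_less[of "0::real"]
  proof eventually_elim
    case (elim r)
    show ?case
    proof (intro allI impI)
      fix \<theta>0 \<theta>1 assume \<theta>: "concentrated_at \<Omega> x r \<theta>0" "concentrated_at \<Omega> z r \<theta>1"
      obtain \<theta> C where b: "concentrated_at \<Omega> y r \<theta>" "C \<ge> 0"
        "\<And>A. A \<in> sets borel \<Longrightarrow> emeasure \<theta> A \<le> ennreal C * emeasure \<mu> A"
        using blob[OF y elim(3)] by blast
      have "catalytic_plan p \<Omega> \<mu> (emeasure \<theta>0) (emeasure \<theta>) (ennreal (c + e))"
        "catalytic_plan p \<Omega> \<mu> (emeasure \<theta>) (emeasure \<theta>1) (ennreal (d + e))"
        using elim(1,2) \<theta> b(1) by blast+
      from catalytic_plan_add[OF this]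
      have "catalytic_plan p \<Omega> \<mu> (\<lambda>A. emeasure \<theta>0 A + emeasure \<theta> A) (\<lambda>A. emeasure \<theta>1 A + emeasure \<theta> A) (ennreal c')"
        by (rule catalytic_plan_mono) (use c e in \<open>auto simp: add.commute simp flip: ennreal_plus\<close>)
      then show "catalytic_plan p \<Omega> \<mu> (emeasure \<theta>0) (emeasure \<theta>1) (ennreal c')"
        by (rule catalytic_plan_cancel) (use b in \<open>auto simp: concentrated_at_def\<close>)
    qed
  qed
qed

text \<open>A curve of length \<open>L\<close>, cut into \<open>n\<close> pieces, costs \<open>n (L/n)\<^sup>p\<close>, which tends to 0 because \<open>p > 1\<close>.\<close>

lemma linked_lipschitz:
  fixes \<gamma> :: "real \<Rightarrow> 'a"
  assumes lip: "L-lipschitz_on {0..1} \<gamma>" and \<gamma>: "\<And>s. s \<in> {0..1} \<Longrightarrow> \<gamma> s \<in> supp \<mu>"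
  shows "linked p \<Omega> \<mu> (\<gamma> 0) (\<gamma> 1) 0"
proof (rule linked_closure)
  fix c' :: real assume c': "0 < c'"
  have L: "0 \<le> L" using lip by (rule lipschitz_on_nonneg)
  have step: "linked p \<Omega> \<mu> (\<gamma> 0) (\<gamma> (real i / real n)) (real i * (L / real n) powr p)" if "i \<le> n" "n > 0" for i n :: nat
    using that(1)
  proof (induction i)
    case 0
    show ?case by (simp add: linked_refl)
  next
    case (Suc i)
    have in01: "real i / real n \<in> {0..1}" "real (Suc i) / real n \<in> {0..1}" using Suc.prems that(2) by auto
    have "dist (\<gamma> (real i / real n)) (\<gamma> (real (Suc i) / real n)) \<le> L * dist (real i / real n) (real (Suc i) / real n)"
      using lip in01 by (rule lipschitz_onD)
    also have "\<dots> = L / real n" using that(2) by (simp add: dist_real_def field_simps)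
    finally have "linked p \<Omega> \<mu> (\<gamma> (real i / real n)) (\<gamma> (real (Suc i) / real n)) ((L / real n) powr p)"
      using p by (intro linked_mono[OF linked_dist] powr_mono2) auto
    with Suc have "linked p \<Omega> \<mu> (\<gamma> 0) (\<gamma> (real (Suc i) / real n)) (real i * (L / real n) powr p + (L / real n) powr p)"
      by (intro linked_trans[where y = "\<gamma> (real i / real n)"] \<gamma> in01) auto
    then show ?case by (simp add: algebra_simps)
  qed
  have "((\<lambda>n. L powr p * real n powr (1 - p)) \<longlongrightarrow> L powr p * 0) sequentially"
    using p by (intro tendsto_mult tendsto_const tendsto_neg_powr filterlim_real_sequentially) auto
  then have "\<forall>\<^sub>F n in sequentially. L powr p * real n powr (1 - p) < c'"
    using c' by (intro order_tendstoD(2)) auto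
  from eventually_happens'[OF sequentially_bot eventually_conj[OF eventually_gt_at_top[of 0] this]]
  obtain n :: nat where n: "n > 0" "L powr p * real n powr (1 - p) < c'" by blast
  have "real n * (L / real n) powr p = L powr p * real n powr (1 - p)"
    using n(1) L by (simp add: powr_divide powr_diff)
  with step[of n n] n show "\<exists>d<c'. linked p \<Omega> \<mu> (\<gamma> 0) (\<gamma> 1) d"
    by (intro exI[of _ "real n * (L / real n) powr p"]) auto
qed

text \<open>As D has positive mass it contains some \<open>b\<close>. The Lipschitz curves with this
  parameter join each \<open>y j\<close> to its successor inside the support, so every step is
  free.\<close>

lemma linked_strongly_connected:
  assumes conn: "strongly_d_connected TYPE('b) d M" and M: "supp M \<subseteq> supp \<mu>"
    and x: "x0 \<in> supp M" "x1 \<in> supp M"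
  shows "linked p \<Omega> \<mu> x0 x1 0"
proof -
  obtain L K N and D :: "'b measure" where D: "0 < emeasure D (space D)"
    and *: "\<forall>x0\<in>supp M. \<forall>x1\<in>supp M. \<exists>(n::nat) (y::nat \<Rightarrow> 'a) (\<Phi>::nat \<Rightarrow> real \<times> 'b \<Rightarrow> 'a).
          1 \<le> n \<and> n \<le> N \<and> y 1 = x0 \<and> y n = x1 \<and> (\<forall>i\<in>{1..n}. y i \<in> supp M) \<and>
          (\<forall>j\<in>{1..<n}.
             \<Phi> j \<in> measurable (rho_measure K d D) borel \<and>
             (\<forall>s\<in>{0..1}. \<forall>b\<in>space D. \<Phi> j (s, b) \<in> supp M) \<and>
             (\<forall>b\<in>space D. L-lipschitz_on {0..1} (\<lambda>s. \<Phi> j (s, b))) \<and>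
             inj_on (\<Phi> j) ({0<..<1} \<times> space D) \<and>
             (\<forall>b\<in>space D. \<Phi> j (0, b) = y j \<and> \<Phi> j (1, b) = y (Suc j)) \<and>
             (\<forall>A\<in>sets borel. emeasure (distr (rho_measure K d D) borel (\<Phi> j)) A \<le> emeasure M A))"
    using conn unfolding strongly_d_connected_def by blast
  from D obtain b where b: "b \<in> space D" by (cases "space D = {}") auto
  obtain n y \<Phi> where n: "1 \<le> n" "n \<le> N" "y 1 = x0" "y n = x1" "\<forall>i\<in>{1..n}. y i \<in> supp M"
    and \<Phi>: "\<forall>j\<in>{1..<n}.
             \<Phi> j \<in> measurable (rho_measure K d D) borel \<and>
             (\<forall>s\<in>{0..1}. \<forall>b\<in>space D. \<Phi> j (s, b) \<in> supp M) \<and>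
             (\<forall>b\<in>space D. L-lipschitz_on {0..1} (\<lambda>s. \<Phi> j (s, b))) \<and>
             inj_on (\<Phi> j) ({0<..<1} \<times> space D) \<and>
             (\<forall>b\<in>space D. \<Phi> j (0, b) = y j \<and> \<Phi> j (1, b) = y (Suc j)) \<and>
             (\<forall>A\<in>sets borel. emeasure (distr (rho_measure K d D) borel (\<Phi> j)) A \<le> emeasure M A)"
    using *[rule_format, OF x] by (elim exE conjE) (rule that; assumption)
  have curve: "L-lipschitz_on {0..1} (\<lambda>s. \<Phi> j (s, b))" "\<Phi> j (0, b) = y j" "\<Phi> j (1, b) = y (Suc j)"
    "\<And>s. s \<in> {0..1} \<Longrightarrow> \<Phi> j (s, b) \<in> supp \<mu>" if "j \<in> {1..<n}" for j
    using bspec[OF \<Phi> that] b M by blast+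
  have "linked p \<Omega> \<mu> x0 (y i) 0" if "1 \<le> i" "i \<le> n" for i
    using that
  proof (induction i rule: nat_induct_at_least)
    case base
    then show ?case using n(3) linked_refl by simp
  next
    case (Suc i)
    have i: "i \<in> {1..<n}" using Suc by auto
    have "linked p \<Omega> \<mu> (\<Phi> i (0, b)) (\<Phi> i (1, b)) 0"
      by (rule linked_lipschitz[OF curve(1)[OF i] curve(4)[OF i]])
    then have "linked p \<Omega> \<mu> (y i) (y (Suc i)) 0" using curve[OF i] by simp
    then have "linked p \<Omega> \<mu> x0 (y (Suc i)) (0 + 0)"
      using Suc n(5) M by (intro linked_trans[where y = "y i"]) auto
    then show ?case by simp
  qed
  from this[of n] n show ?thesis by simp
qed

text \<open>Cover \<open>K\<close> by finitely many balls small enough for the links to \<open>a\<close> to be cheap.\<close>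

lemma gather_measure:
  fixes \<nu> :: "'a measure"
  assumes \<nu>: "finite_measure \<nu>" "sets \<nu> = sets borel" and K: "compact K" "K \<subseteq> \<Omega>"
    and link: "\<And>x. x \<in> K \<Longrightarrow> linked p \<Omega> \<mu> x a 0" and \<eta>: "0 < \<eta>"
  shows "\<forall>\<^sub>F r in at_right 0. \<forall>\<theta>. concentrated_at \<Omega> a r \<theta> \<longrightarrow>
    catalytic_plan p \<Omega> \<mu> (\<lambda>A. emeasure \<nu> (A \<inter> K)) (\<lambda>A. emeasure \<nu> K * emeasure \<theta> A) (emeasure \<nu> K * ennreal \<eta>)"
proof -
  interpret finite_measure \<nu> by fact
  have "\<exists>r>0. \<forall>\<theta>0 \<theta>1. concentrated_at \<Omega> x r \<theta>0 \<longrightarrow> concentrated_at \<Omega> a r \<theta>1 \<longrightarrow>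
      catalytic_plan p \<Omega> \<mu> (emeasure \<theta>0) (emeasure \<theta>1) (ennreal \<eta>)" if "x \<in> K" for x
  proof -
    have "\<forall>\<^sub>F r in at_right 0. \<forall>\<theta>0 \<theta>1. concentrated_at \<Omega> x r \<theta>0 \<longrightarrow> concentrated_at \<Omega> a r \<theta>1 \<longrightarrow>
      catalytic_plan p \<Omega> \<mu> (emeasure \<theta>0) (emeasure \<theta>1) (ennreal \<eta>)"
      using link[OF that] \<eta> unfolding linked_def by simp
    from eventually_happens'[OF _ eventually_conj[OF this eventually_at_right_less[of "0::real"]]]
    show ?thesis by auto
  qed
  then obtain R where R: "\<And>x. x \<in> K \<Longrightarrow> R x > 0"
    "\<And>x \<theta>0 \<theta>1. x \<in> K \<Longrightarrow> concentrated_at \<Omega> x (R x) \<theta>0 \<Longrightarrow> concentrated_at \<Omega> a (R x) \<theta>1 \<Longrightarrow>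
      catalytic_plan p \<Omega> \<mu> (emeasure \<theta>0) (emeasure \<theta>1) (ennreal \<eta>)"
    by metis
  obtain X where X: "X \<subseteq> K" "finite X" "K \<subseteq> (\<Union>x\<in>X. ball x (R x))"
  proof (rule compactE_image[OF K(1), of K "\<lambda>x. ball x (R x)"])
    show "K \<subseteq> (\<Union>x\<in>K. ball x (R x))" using R(1) by force
  qed auto
  \<comment> \<open>Each \<open>R x\<close> depends on \<open>x\<close>; finiteness of
    \<open>X\<close> allows one radius below all of them, and a blob of radius \<open>r\<close> at
    \<open>a\<close> is also one of radius \<open>R x\<close>.\<close>
  have "\<forall>\<^sub>F r in at_right 0. \<forall>x\<in>X. r < R x"
    using X R(1) by (intro eventually_ball_finite ballI eventually_at_rightI[of 0]) auto
  then show ?thesis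
  proof (rule eventually_mono, intro allI impI)
    fix r \<theta> assume r: "\<forall>x\<in>X. r < R x" and \<theta>: "concentrated_at \<Omega> a r \<theta>"
    \<comment> \<open>Inside one ball, normalising turns the piece of \<nu> into a blob, and the
      resulting plan is scaled back by the mass. A null piece cannot be normalised; the zero plan
      handles it.\<close>
    have piece: "catalytic_plan p \<Omega> \<mu> (\<lambda>A. emeasure \<nu> (A \<inter> B)) (\<lambda>A. emeasure \<nu> B * emeasure \<theta> A) (emeasure \<nu> B * ennreal \<eta>)"
      if B: "B \<in> sets borel" "B \<subseteq> \<Omega> \<inter> ball x (R x)" "x \<in> X" for B x
    proof (cases "emeasure \<nu> B = 0")
      case True
      have "emeasure \<nu> (A \<inter> B) = 0" if "A \<in> sets borel" for A
        using emeasure_mono[of "A \<inter> B" B \<nu>] True that B \<nu> by simp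
      with True show ?thesis
        by (intro catalytic_plan_mono[OF catalytic_plan_zero]) auto
    next
      case False
      have x: "x \<in> K" "r \<le> R x" using B(3) X r by auto
      have "concentrated_at \<Omega> x (R x) (uniform_measure \<nu> B)"
        using B \<nu> \<Omega> False by (intro concentrated_at_uniform_measure) auto
      then have "catalytic_plan p \<Omega> \<mu> (emeasure (uniform_measure \<nu> B)) (emeasure \<theta>) (ennreal \<eta>)"
        using concentrated_at_mono[OF \<theta> x(2) \<Omega>] by (rule R(2)[OF x(1)])
      then have plan: "catalytic_plan p \<Omega> \<mu> (\<lambda>A. emeasure \<nu> B * emeasure (uniform_measure \<nu> B) A)
          (\<lambda>A. emeasure \<nu> B * emeasure \<theta> A) (emeasure \<nu> B * ennreal \<eta>)"
        by (rule catalytic_plan_scale) (simp add: less_top[symmetric])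
      have "emeasure \<nu> (A \<inter> B) = emeasure \<nu> B * emeasure (uniform_measure \<nu> B) A" if "A \<in> sets borel" for A
      proof -
        have "emeasure (uniform_measure \<nu> B) A = emeasure \<nu> (A \<inter> B) / emeasure \<nu> B"
          using that B(1) \<nu>(2) by (simp add: Int_commute)
        moreover have "emeasure \<nu> (A \<inter> B) * emeasure \<nu> B / emeasure \<nu> B = emeasure \<nu> (A \<inter> B)"
          using False by (intro mult_divide_eq_ennreal) auto
        ultimately show ?thesis
          by (simp only: ennreal_times_divide mult.commute[of "emeasure \<nu> B"])
      qed
      with plan show ?thesis by (rule catalytic_plan_mono[OF _ order_refl]) simp_all
    qed
    \<comment> \<open>The balls overlap, so the induction cuts one ball at a time out of a varying
      set \<open>B\<close>, which keeps the pieces disjoint.\<close>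
    have "finite Y \<Longrightarrow> Y \<subseteq> X \<Longrightarrow> B \<in> sets borel \<Longrightarrow> B \<subseteq> \<Omega> \<inter> (\<Union>x\<in>Y. ball x (R x)) \<Longrightarrow>
      catalytic_plan p \<Omega> \<mu> (\<lambda>A. emeasure \<nu> (A \<inter> B)) (\<lambda>A. emeasure \<nu> B * emeasure \<theta> A) (emeasure \<nu> B * ennreal \<eta>)" for Y B
    proof (induction Y arbitrary: B rule: finite_induct)
      case empty
      then show ?case by (simp add: catalytic_plan_zero)
    next
      case (insert x Y)
      let ?B = "B \<inter> ball x (R x)" and ?C = "B - ball x (R x)"
      have sets: "?B \<in> sets borel" "?C \<in> sets borel" using insert.prems by auto
      have "catalytic_plan p \<Omega> \<mu> (\<lambda>A. emeasure \<nu> (A \<inter> ?B)) (\<lambda>A. emeasure \<nu> ?B * emeasure \<theta> A) (emeasure \<nu> ?B * ennreal \<eta>)"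
        using insert.prems sets by (intro piece) auto
      moreover have "catalytic_plan p \<Omega> \<mu> (\<lambda>A. emeasure \<nu> (A \<inter> ?C)) (\<lambda>A. emeasure \<nu> ?C * emeasure \<theta> A) (emeasure \<nu> ?C * ennreal \<eta>)"
        using insert.prems sets by (intro insert.IH) auto
      ultimately have plan: "catalytic_plan p \<Omega> \<mu> (\<lambda>A. emeasure \<nu> (A \<inter> ?B) + emeasure \<nu> (A \<inter> ?C))
        (\<lambda>A. emeasure \<nu> ?B * emeasure \<theta> A + emeasure \<nu> ?C * emeasure \<theta> A) (emeasure \<nu> ?B * ennreal \<eta> + emeasure \<nu> ?C * ennreal \<eta>)"
        by (rule catalytic_plan_add)
      have split: "emeasure \<nu> (A \<inter> B) = emeasure \<nu> (A \<inter> ?B) + emeasure \<nu> (A \<inter> ?C)" if "A \<in> sets borel" for A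
      proof -
        have "A \<inter> B = (A \<inter> ?B) \<union> (A \<inter> ?C)" by auto
        then show ?thesis using that sets \<nu>(2) by (simp only:) (rule plus_emeasure[symmetric], auto)
      qed
      have "emeasure \<nu> B = emeasure \<nu> ?B + emeasure \<nu> ?C" using split[of UNIV] by simp
      with plan split show ?case
        by (intro catalytic_plan_mono[OF plan]) (simp_all add: distrib_right)
    qed
    from this[OF X(2) subset_refl, of K] X(3) K
    show "catalytic_plan p \<Omega> \<mu> (\<lambda>A. emeasure \<nu> (A \<inter> K)) (\<lambda>A. emeasure \<nu> K * emeasure \<theta> A) (emeasure \<nu> K * ennreal \<eta>)"
      by (auto simp: borel_compact)
  qed
qed

end

section \<open>Flows and path lengths on a finite graph\<close>

text \<open>Vertex \<open>k\<close> has more outflow than inflow: everything that enters it is passed on, in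
  proportion to its outgoing flow.\<close>

lemma reroute_flow:
  fixes d f :: "'v \<Rightarrow> 'v \<Rightarrow> real"
  assumes V: "finite V" and k: "k \<in> V"
    and d0: "\<And>i j. i \<in> V \<Longrightarrow> j \<in> V \<Longrightarrow> 0 \<le> d i j"
    and tri: "\<And>i j l. i \<in> V \<Longrightarrow> j \<in> V \<Longrightarrow> l \<in> V \<Longrightarrow> d i l \<le> d i j + d j l"
    and f0: "\<And>i j. i \<in> V \<Longrightarrow> j \<in> V \<Longrightarrow> 0 \<le> f i j"
    and out: "(\<Sum>j\<in>V. f k j) \<ge> (\<Sum>j\<in>V. f j k)"
  shows "\<exists>g. (\<forall>i\<in>V. \<forall>j\<in>V. 0 \<le> g i j)
    \<and> (\<forall>i\<in>V. (\<Sum>j\<in>V. g i j) - (\<Sum>j\<in>V. g j i) = (\<Sum>j\<in>V. f i j) - (\<Sum>j\<in>V. f j i))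
    \<and> (\<Sum>i\<in>V. \<Sum>j\<in>V. g i j * d i j) \<le> (\<Sum>i\<in>V. \<Sum>j\<in>V. f i j * d i j)
    \<and> (\<forall>i\<in>V. g i k = 0)
    \<and> (\<forall>l\<in>V. (\<forall>i\<in>V. f i l = 0) \<longrightarrow> (\<forall>i\<in>V. g i l = 0))
    \<and> (\<forall>l\<in>V. (\<forall>j\<in>V. f l j = 0) \<longrightarrow> (\<forall>j\<in>V. g l j = 0))"
proof -
  \<comment> \<open>A loop at \<open>k\<close> contributes equally to inflow and outflow; working on
    \<open>W\<close> leaves it out of both.\<close>
  define W where "W = V - {k}"
  have W: "finite W" "k \<notin> W" "V = insert k W" using V k by (auto simp: W_def)
  define outk where "outk = (\<Sum>j\<in>W. f k j)"
  define ink where "ink = (\<Sum>i\<in>W. f i k)"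
  have io: "ink \<le> outk" "0 \<le> ink" using out f0 W by (auto simp: ink_def outk_def intro!: sum_nonneg)
  have split: "sum h V = h k + sum h W" for h :: "'v \<Rightarrow> real" using W by simp
  \<comment> \<open>If \<open>outk = 0\<close>, all edges between \<open>k\<close> and
    \<open>W\<close> are empty, so the value 0 of a division by 0 is the right one in the quotients
    below.\<close>
  have zero: "f k j = 0" if "outk = 0" "j \<in> W" for j
    using that W f0 sum_nonneg_eq_0_iff[of W "f k"] by (auto simp: outk_def)
  have zero': "f i k = 0" if "outk = 0" "i \<in> W" for i
    using that W f0 io sum_nonneg_eq_0_iff[of W "\<lambda>i. f i k"] by (auto simp: ink_def)
  \<comment> \<open>The flow from \<open>i\<close> into \<open>k\<close> is split among the
    successors \<open>j\<close> with shares \<open>f k j / outk\<close> and sent there directly. The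
    fraction \<open>ink / outk\<close> of each outgoing edge of \<open>k\<close> is thereby used up;
    the rest originates at \<open>k\<close> and stays.\<close>
  define g where "g i j = (if j = k then 0 else if i = k then f k j * (1 - ink / outk)
    else f i j + f i k * f k j / outk)" for i j
  have gW: "g i j = f i j + f i k * f k j / outk" if "i \<in> W" "j \<in> W" for i j
    using that W by (auto simp: g_def)
  have gk: "g k j = f k j * (1 - ink / outk)" "g j k = 0" "g k k = 0" if "j \<in> W" for j
    using that W by (auto simp: g_def)
  have gkk: "g k k = 0" by (simp add: g_def)
  have frac: "0 \<le> 1 - ink / outk" using io by (cases "outk = 0") (auto simp: field_simps)
  have g0: "0 \<le> g i j" if "i \<in> V" "j \<in> V" for i j
    using that f0 frac io k unfolding g_def by (auto intro!: mult_nonneg_nonneg add_nonneg_nonneg divide_nonneg_nonneg)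
  have div: "(\<Sum>j\<in>V. g i j) - (\<Sum>j\<in>V. g j i) = (\<Sum>j\<in>V. f i j) - (\<Sum>j\<in>V. f j i)" if "i \<in> V" for i
  proof (cases "i = k")
    case True
    have "(\<Sum>j\<in>W. g k j) = outk * (1 - ink / outk)"
      using gk by (simp add: outk_def sum_distrib_right)
    also have "\<dots> = outk - ink" using io by (cases "outk = 0") (auto simp: field_simps)
    finally show ?thesis using True gk gkk by (simp add: split ink_def outk_def)
  next
    case False
    then have i: "i \<in> W" using that W by auto
    have "(\<Sum>j\<in>W. g i j) = (\<Sum>j\<in>W. f i j) + f i k * outk / outk"
      using i by (simp add: gW sum.distrib outk_def sum_distrib_left sum_divide_distrib)
    also have "f i k * outk / outk = f i k" using zero'[OF _ i] by (cases "outk = 0") auto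
    finally have 1: "(\<Sum>j\<in>W. g i j) = (\<Sum>j\<in>W. f i j) + f i k" .
    have "(\<Sum>j\<in>W. g j i) = (\<Sum>j\<in>W. f j i) + ink * f k i / outk"
      using i by (simp add: gW sum.distrib ink_def sum_distrib_right sum_divide_distrib)
    then show ?thesis using 1 gk[OF i] by (simp add: split algebra_simps)
  qed
  have cost: "(\<Sum>i\<in>V. \<Sum>j\<in>V. g i j * d i j) \<le> (\<Sum>i\<in>V. \<Sum>j\<in>V. f i j * d i j)"
  proof -
    \<comment> \<open>Each rerouted portion saves the way over \<open>k\<close> by the triangle
      inequality. Summed up, the two legs are exactly the former cost of entering \<open>k\<close>
      and the used-up fraction of the cost of leaving it.\<close>
    have "(\<Sum>i\<in>W. \<Sum>j\<in>W. f i k * f k j / outk * d i j)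
        \<le> (\<Sum>i\<in>W. \<Sum>j\<in>W. f i k * f k j / outk * (d i k + d k j))"
      using W f0 tri io by (intro sum_mono mult_left_mono) (auto intro!: divide_nonneg_nonneg)
    also have "\<dots> = (\<Sum>i\<in>W. \<Sum>j\<in>W. f i k * d i k * (f k j / outk)) + (\<Sum>i\<in>W. \<Sum>j\<in>W. f i k * (f k j * d k j / outk))"
      by (simp add: algebra_simps add_divide_distrib sum.distrib)
    also have "\<dots> = (\<Sum>i\<in>W. f i k * d i k) * (outk / outk) + ink / outk * (\<Sum>j\<in>W. f k j * d k j)"
      by (simp add: sum_product[symmetric] ink_def outk_def sum_divide_distrib[symmetric])
    also have "(\<Sum>i\<in>W. f i k * d i k) * (outk / outk) = (\<Sum>i\<in>W. f i k * d i k)"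
      using zero' by (cases "outk = 0") auto
    finally have *: "(\<Sum>i\<in>W. \<Sum>j\<in>W. f i k * f k j / outk * d i j)
      \<le> (\<Sum>i\<in>W. f i k * d i k) + ink / outk * (\<Sum>j\<in>W. f k j * d k j)" .
    have "(\<Sum>i\<in>V. \<Sum>j\<in>V. g i j * d i j) = (\<Sum>j\<in>W. g k j * d k j) + (\<Sum>i\<in>W. \<Sum>j\<in>W. g i j * d i j)"
      using gk gkk by (simp add: split)
    also have "(\<Sum>i\<in>W. \<Sum>j\<in>W. g i j * d i j)
      = (\<Sum>i\<in>W. \<Sum>j\<in>W. f i j * d i j) + (\<Sum>i\<in>W. \<Sum>j\<in>W. f i k * f k j / outk * d i j)"
      by (simp add: gW distrib_right sum.distrib)
    also have "(\<Sum>j\<in>W. g k j * d k j) = (\<Sum>j\<in>W. f k j * d k j) - ink / outk * (\<Sum>j\<in>W. f k j * d k j)"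
      by (simp add: gk sum_distrib_left algebra_simps sum_subtractf)
    finally have "(\<Sum>i\<in>V. \<Sum>j\<in>V. g i j * d i j)
      \<le> (\<Sum>j\<in>W. f k j * d k j) + (\<Sum>i\<in>W. \<Sum>j\<in>W. f i j * d i j) + (\<Sum>i\<in>W. f i k * d i k)"
      using * by linarith
    \<comment> \<open>The discarded loop at \<open>k\<close> had nonnegative cost.\<close>
    also have "\<dots> \<le> (\<Sum>i\<in>V. \<Sum>j\<in>V. f i j * d i j)"
      using f0[OF k k] d0[OF k k] by (simp add: split sum.distrib)
    finally show ?thesis .
  qed
  \<comment> \<open>Vertices treated earlier remain treated: every term of \<open>g\<close> in row
    or column \<open>l\<close> has a factor of \<open>f\<close> from the same row or column.\<close>
  show ?thesis
    using g0 div cost k by (intro exI[of _ g]) (auto simp: g_def)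
qed

text \<open>Vertices are treated one after another: a vertex with b \<ge> 0 loses its inflow, one
  with b \<le> 0 its outflow, and a balanced one both. No edge of a treated vertex in the forbidden
  direction ever reappears.\<close>

lemma reduce_flow:
  fixes d f :: "'v \<Rightarrow> 'v \<Rightarrow> real"
  assumes V: "finite V"
    and d0: "\<And>i j. i \<in> V \<Longrightarrow> j \<in> V \<Longrightarrow> 0 \<le> d i j"
    and tri: "\<And>i j l. i \<in> V \<Longrightarrow> j \<in> V \<Longrightarrow> l \<in> V \<Longrightarrow> d i l \<le> d i j + d j l"
    and f0: "\<And>i j. i \<in> V \<Longrightarrow> j \<in> V \<Longrightarrow> 0 \<le> f i j"
    and b: "\<And>i. i \<in> V \<Longrightarrow> (\<Sum>j\<in>V. f i j) - (\<Sum>j\<in>V. f j i) = b i"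
    and W: "W \<subseteq> V"
  shows "\<exists>g. (\<forall>i\<in>V. \<forall>j\<in>V. 0 \<le> g i j)
    \<and> (\<forall>i\<in>V. (\<Sum>j\<in>V. g i j) - (\<Sum>j\<in>V. g j i) = b i)
    \<and> (\<Sum>i\<in>V. \<Sum>j\<in>V. g i j * d i j) \<le> (\<Sum>i\<in>V. \<Sum>j\<in>V. f i j * d i j)
    \<and> (\<forall>l\<in>W. (b l \<ge> 0 \<longrightarrow> (\<forall>i\<in>V. g i l = 0)) \<and> (b l \<le> 0 \<longrightarrow> (\<forall>i\<in>V. g l i = 0)))"
proof -
  have "finite W" using V W by (rule finite_subset[rotated])
  then show ?thesis using W
  proof (induction W)
    case empty
    then show ?case using f0 b by (intro exI[of _ f]) auto
  next
    case (insert k W)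
    then have k: "k \<in> V" and "W \<subseteq> V" by auto
    from insert.IH[OF \<open>W \<subseteq> V\<close>] obtain h where h: "\<forall>i\<in>V. \<forall>j\<in>V. 0 \<le> h i j"
      "\<forall>i\<in>V. (\<Sum>j\<in>V. h i j) - (\<Sum>j\<in>V. h j i) = b i"
      "(\<Sum>i\<in>V. \<Sum>j\<in>V. h i j * d i j) \<le> (\<Sum>i\<in>V. \<Sum>j\<in>V. f i j * d i j)"
      "\<forall>l\<in>W. (b l \<ge> 0 \<longrightarrow> (\<forall>i\<in>V. h i l = 0)) \<and> (b l \<le> 0 \<longrightarrow> (\<forall>i\<in>V. h l i = 0))"
      by blast
    \<comment> \<open>For the balanced case: once nothing enters \<open>k\<close>, the outflow
      equals b k \<le> 0, so nonnegative edges must all vanish.\<close>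
    have zero: "\<forall>j\<in>V. g k j = 0"
      if "\<forall>i\<in>V. \<forall>j\<in>V. 0 \<le> g i j" "(\<Sum>j\<in>V. g k j) - (\<Sum>j\<in>V. g j k) = b k" "\<forall>i\<in>V. g i k = 0" "b k \<le> 0"
      for g :: "'v \<Rightarrow> 'v \<Rightarrow> real"
    proof -
      have "(\<Sum>j\<in>V. g k j) = 0" using that k by (intro antisym sum_nonneg) auto
      then show ?thesis using that(1) k V by (simp add: sum_nonneg_eq_0_iff)
    qed
    show ?case
    proof (cases "b k \<ge> 0")
      case True
      have out: "(\<Sum>j\<in>V. h k j) \<ge> (\<Sum>j\<in>V. h j k)" using True h(2) k by force
      have h0: "0 \<le> h i j" if "i \<in> V" "j \<in> V" for i j using h(1) that by blast
      obtain g where g: "\<forall>i\<in>V. \<forall>j\<in>V. 0 \<le> g i j"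
        "\<forall>i\<in>V. (\<Sum>j\<in>V. g i j) - (\<Sum>j\<in>V. g j i) = (\<Sum>j\<in>V. h i j) - (\<Sum>j\<in>V. h j i)"
        "(\<Sum>i\<in>V. \<Sum>j\<in>V. g i j * d i j) \<le> (\<Sum>i\<in>V. \<Sum>j\<in>V. h i j * d i j)"
        "\<forall>i\<in>V. g i k = 0"
        "\<forall>l\<in>V. (\<forall>i\<in>V. h i l = 0) \<longrightarrow> (\<forall>i\<in>V. g i l = 0)"
        "\<forall>l\<in>V. (\<forall>j\<in>V. h l j = 0) \<longrightarrow> (\<forall>j\<in>V. g l j = 0)"
        by (atomize_elim, rule reroute_flow) (fact V k d0 tri h0 out)+
      have "\<forall>i\<in>V. (\<Sum>j\<in>V. g i j) - (\<Sum>j\<in>V. g j i) = b i" using g(2) h(2) by simp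
      moreover have "\<forall>j\<in>V. g k j = 0" if "b k \<le> 0"
        using zero[of g] g(1,4) calculation k that by blast
      moreover have "(b l \<ge> 0 \<longrightarrow> (\<forall>i\<in>V. g i l = 0)) \<and> (b l \<le> 0 \<longrightarrow> (\<forall>i\<in>V. g l i = 0))" if "l \<in> W" for l
        using g(5,6) h(4) that \<open>W \<subseteq> V\<close> by blast
      ultimately show ?thesis using g(1,4) order_trans[OF g(3) h(3)]
        by (intro exI[of _ g]) auto
    next
      \<comment> \<open>Reversing all edges and the distance turns the sink \<open>k\<close> into a
        source; the triangle inequality survives the reversal.\<close>
      case False
      have "(\<Sum>j\<in>V. h j k) \<ge> (\<Sum>j\<in>V. h k j)" using False h(2) k by force
      moreover have "d l i \<le> d j i + d l j" if "i \<in> V" "j \<in> V" "l \<in> V" for i j l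
        using tri[of l j i] that by simp
      ultimately have "\<exists>g. (\<forall>i\<in>V. \<forall>j\<in>V. 0 \<le> g i j)
        \<and> (\<forall>i\<in>V. (\<Sum>j\<in>V. g i j) - (\<Sum>j\<in>V. g j i) = (\<Sum>j\<in>V. h j i) - (\<Sum>j\<in>V. h i j))
        \<and> (\<Sum>i\<in>V. \<Sum>j\<in>V. g i j * d j i) \<le> (\<Sum>i\<in>V. \<Sum>j\<in>V. h j i * d j i)
        \<and> (\<forall>i\<in>V. g i k = 0)
        \<and> (\<forall>l\<in>V. (\<forall>i\<in>V. h l i = 0) \<longrightarrow> (\<forall>i\<in>V. g i l = 0))
        \<and> (\<forall>l\<in>V. (\<forall>j\<in>V. h j l = 0) \<longrightarrow> (\<forall>j\<in>V. g l j = 0))"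
        using h(1) d0 by (intro reroute_flow[where f = "\<lambda>i j. h j i" and d = "\<lambda>i j. d j i"] V k) auto
      then
      obtain g' where g': "\<forall>i\<in>V. \<forall>j\<in>V. 0 \<le> g' i j"
        "\<forall>i\<in>V. (\<Sum>j\<in>V. g' i j) - (\<Sum>j\<in>V. g' j i) = (\<Sum>j\<in>V. h j i) - (\<Sum>j\<in>V. h i j)"
        "(\<Sum>i\<in>V. \<Sum>j\<in>V. g' i j * d j i) \<le> (\<Sum>i\<in>V. \<Sum>j\<in>V. h j i * d j i)"
        "\<forall>i\<in>V. g' i k = 0"
        "\<forall>l\<in>V. (\<forall>i\<in>V. h l i = 0) \<longrightarrow> (\<forall>i\<in>V. g' i l = 0)"
        "\<forall>l\<in>V. (\<forall>j\<in>V. h j l = 0) \<longrightarrow> (\<forall>j\<in>V. g' l j = 0)"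
        by (elim exE conjE) (rule that; assumption)
      define g where "g i j = g' j i" for i j
      have "\<forall>i\<in>V. (\<Sum>j\<in>V. g i j) - (\<Sum>j\<in>V. g j i) = b i"
        using g'(2) h(2) unfolding g_def by force
      moreover have "(\<Sum>i\<in>V. \<Sum>j\<in>V. g i j * d i j) \<le> (\<Sum>i\<in>V. \<Sum>j\<in>V. h i j * d i j)"
        using g'(3) sum.swap[of "\<lambda>i j. g' i j * d j i" V V] sum.swap[of "\<lambda>i j. h j i * d j i" V V]
        unfolding g_def by linarith
      moreover have "(b l \<ge> 0 \<longrightarrow> (\<forall>i\<in>V. g i l = 0)) \<and> (b l \<le> 0 \<longrightarrow> (\<forall>i\<in>V. g l i = 0))" if "l \<in> W" for l
        using g'(5,6) h(4) that \<open>W \<subseteq> V\<close> unfolding g_def by blast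
      ultimately show ?thesis using g'(1,4) h(3) False unfolding g_def
        by (intro exI[of _ "\<lambda>i j. g' j i"]) auto
    qed
  qed
qed

text \<open>After the reduction, edges start only at vertices with b > 0 and end only at vertices
  with b < 0, so the divergences of the flow become the row and column sums of a transport
  matrix.\<close>

lemma flow_to_plan:
  fixes d f :: "'v \<Rightarrow> 'v \<Rightarrow> real" and b :: "'v \<Rightarrow> real"
  assumes V: "finite V"
    and d0: "\<And>i j. i \<in> V \<Longrightarrow> j \<in> V \<Longrightarrow> 0 \<le> d i j"
    and tri: "\<And>i j l. i \<in> V \<Longrightarrow> j \<in> V \<Longrightarrow> l \<in> V \<Longrightarrow> d i l \<le> d i j + d j l"
    and f0: "\<And>i j. i \<in> V \<Longrightarrow> j \<in> V \<Longrightarrow> 0 \<le> f i j"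
    and b: "\<And>i. i \<in> V \<Longrightarrow> (\<Sum>j\<in>V. f i j) - (\<Sum>j\<in>V. f j i) = b i"
  shows "\<exists>g. (\<forall>i\<in>{j\<in>V. b j > 0}. \<forall>j\<in>{j\<in>V. b j < 0}. 0 \<le> g i j)
    \<and> (\<forall>i\<in>{j\<in>V. b j > 0}. (\<Sum>j\<in>{j\<in>V. b j < 0}. g i j) = b i)
    \<and> (\<forall>j\<in>{j\<in>V. b j < 0}. (\<Sum>i\<in>{j\<in>V. b j > 0}. g i j) = - b j)
    \<and> (\<Sum>i\<in>{j\<in>V. b j > 0}. \<Sum>j\<in>{j\<in>V. b j < 0}. g i j * d i j) \<le> (\<Sum>i\<in>V. \<Sum>j\<in>V. f i j * d i j)"
proof -
  obtain g where g: "\<forall>i\<in>V. \<forall>j\<in>V. 0 \<le> g i j"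
    "\<forall>i\<in>V. (\<Sum>j\<in>V. g i j) - (\<Sum>j\<in>V. g j i) = b i"
    "(\<Sum>i\<in>V. \<Sum>j\<in>V. g i j * d i j) \<le> (\<Sum>i\<in>V. \<Sum>j\<in>V. f i j * d i j)"
    "\<forall>l\<in>V. (b l \<ge> 0 \<longrightarrow> (\<forall>i\<in>V. g i l = 0)) \<and> (b l \<le> 0 \<longrightarrow> (\<forall>i\<in>V. g l i = 0))"
    by (atomize_elim, rule reduce_flow) (fact assms subset_refl)+
  let ?P = "{j\<in>V. b j > 0}" and ?M = "{j\<in>V. b j < 0}"
  \<comment> \<open>The weight \<open>h\<close> lets one identity serve the row sums (constant 1)
    and the cost (\<open>d i\<close>).\<close>
  have row: "(\<Sum>j\<in>?M. g i j * h j) = (\<Sum>j\<in>V. g i j * h j)" if "i \<in> V" for i and h :: "'v \<Rightarrow> real"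
    using V g(4) that by (intro sum.mono_neutral_left) (auto simp: not_less)
  have col: "(\<Sum>i\<in>?P. g i j * h i) = (\<Sum>i\<in>V. g i j * h i)" if "j \<in> V" for j and h :: "'v \<Rightarrow> real"
    using V g(4) that by (intro sum.mono_neutral_left) (auto simp: not_less)
  have 1: "(\<Sum>j\<in>?M. g i j) = b i" if "i \<in> ?P" for i
    using row[of i "\<lambda>_. 1"] that g(2,4) by auto
  have 2: "(\<Sum>i\<in>?P. g i j) = - b j" if "j \<in> ?M" for j
    using col[of j "\<lambda>_. 1"] that g(2)[rule_format, of j] g(4) by auto
  have "(\<Sum>i\<in>?P. \<Sum>j\<in>?M. g i j * d i j) = (\<Sum>i\<in>?P. \<Sum>j\<in>V. g i j * d i j)"
    by (rule sum.cong[OF refl row]) auto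
  also have "\<dots> \<le> (\<Sum>i\<in>V. \<Sum>j\<in>V. g i j * d i j)"
    using V g(1) d0 by (intro sum_mono2 sum_nonneg) auto
  finally show ?thesis using g 1 2 by (intro exI[of _ g]) auto
qed

section \<open>Geodesic distance as an infimum of path lengths\<close>

lemma path_length_singleton [simp]: "path_length E [i] = 0"
  by (simp add: path_length_def)

lemma path_length_Cons: "path_length E (i # j # ks) = E i j + path_length E (j # ks)"
  by (simp add: path_length_def sum.lessThan_Suc_shift del: sum.lessThan_Suc)

lemma path_length_nonneg:
  assumes "\<And>i j. i \<in> set ks \<Longrightarrow> j \<in> set ks \<Longrightarrow> 0 \<le> E i j"
  shows "0 \<le> path_length E ks"
  unfolding path_length_def using assms by (intro sum_nonneg) auto

lemma path_length_append:
  "ks \<noteq> [] \<Longrightarrow> path_length E (ks @ ls) = path_length E ks + path_length E (last ks # ls)"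
proof (induction ks)
  case (Cons a ks)
  then show ?case by (cases ks) (auto simp: path_length_Cons)
qed simp

context
  fixes V :: "nat set" and E :: "nat \<Rightarrow> nat \<Rightarrow> real"
  assumes E0: "\<And>i j. i \<in> V \<Longrightarrow> j \<in> V \<Longrightarrow> 0 \<le> E i j"
begin

lemma path_lengths_bdd_below:
  "bdd_below {path_length E ks | ks. ks \<noteq> [] \<and> hd ks = i \<and> last ks = j \<and> set ks \<subseteq> V}"
  using E0 by (intro bdd_belowI[of _ 0]) (auto intro!: path_length_nonneg)

lemma geodesic_dist_le:
  assumes "ks \<noteq> []" "hd ks = i" "last ks = j" "set ks \<subseteq> V"
  shows "geodesic_dist V E i j \<le> path_length E ks"
  unfolding geodesic_dist_def using assms by (intro cInf_lower path_lengths_bdd_below) auto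

text \<open>Gives near-optimal paths, which is enough everywhere, so that attainment of the infimum
  is never discussed. The path \<open>[i, j]\<close> shows that the set is nonempty.\<close>

lemma geodesic_dist_less_iff:
  assumes "i \<in> V" "j \<in> V"
  shows "geodesic_dist V E i j < c \<longleftrightarrow>
    (\<exists>ks. ks \<noteq> [] \<and> hd ks = i \<and> last ks = j \<and> set ks \<subseteq> V \<and> path_length E ks < c)"
proof -
  have "path_length E [i, j] \<in> {path_length E ks | ks. ks \<noteq> [] \<and> hd ks = i \<and> last ks = j \<and> set ks \<subseteq> V}"
    using assms by (intro CollectI exI[of _ "[i, j]"]) auto
  then show ?thesis
    unfolding geodesic_dist_def by (subst cInf_less_iff[OF _ path_lengths_bdd_below]) blast+
qed

lemma geodesic_dist_nonneg:
  assumes "i \<in> V" "j \<in> V"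
  shows "0 \<le> geodesic_dist V E i j"
proof (rule ccontr)
  assume "\<not> ?thesis"
  then obtain ks where "set ks \<subseteq> V" "path_length E ks < 0"
    using geodesic_dist_less_iff[OF assms, of 0] by auto
  moreover have "0 \<le> path_length E ks" using calculation E0 by (intro path_length_nonneg) auto
  ultimately show False by simp
qed

lemma geodesic_dist_le_edge: "i \<in> V \<Longrightarrow> j \<in> V \<Longrightarrow> geodesic_dist V E i j \<le> E i j"
  using geodesic_dist_le[of "[i, j]" i j] by (simp add: path_length_Cons)

lemma geodesic_dist_triangle:
  assumes "i \<in> V" "j \<in> V" "l \<in> V"
  shows "geodesic_dist V E i l \<le> geodesic_dist V E i j + geodesic_dist V E j l"
proof (rule field_le_epsilon)
  fix e :: real assume "0 < e"
  then obtain ks ls where ks: "ks \<noteq> []" "hd ks = i" "last ks = j" "set ks \<subseteq> V"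
      "path_length E ks < geodesic_dist V E i j + e / 2"
    and ls: "ls \<noteq> []" "hd ls = j" "last ls = l" "set ls \<subseteq> V"
      "path_length E ls < geodesic_dist V E j l + e / 2"
    using geodesic_dist_less_iff[of i j "geodesic_dist V E i j + e / 2"]
      geodesic_dist_less_iff[of j l "geodesic_dist V E j l + e / 2"] assms by auto
  \<comment> \<open>\<open>tl ls\<close> drops the second copy of \<open>j\<close>, which would
    otherwise add the term \<open>E j j\<close>.\<close>
  have "geodesic_dist V E i l \<le> path_length E (ks @ tl ls)"
    using ks ls by (intro geodesic_dist_le) (auto simp: last_append last_tl dest: list.set_sel(2), cases ls, auto)
  also have "\<dots> = path_length E ks + path_length E ls"
    using ks ls by (cases ls) (auto simp: path_length_append)
  finally show "geodesic_dist V E i l \<le> geodesic_dist V E i j + geodesic_dist V E j l + e"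
    using ks(5) ls(5) by simp
qed

end

section \<open>Lower bound\<close>

text \<open>Powers of set distances violate the triangle inequality in general. The cost of the flow
  of masses is therefore first lowered from \<open>E\<close> to the geodesic distance, and only then
  is the flow rerouted.\<close>

lemma plan_of_coupling:
  fixes A :: "nat \<Rightarrow> 'a::euclidean_space set"
  assumes \<pi>: "\<pi> \<in> couplings \<Omega> M1 M2" and M1: "finite_measure M1"
    and V: "finite V" and A: "\<And>j. j \<in> V \<Longrightarrow> closed (A j)" and disj: "disjoint_family_on A V"
    and null: "emeasure M1 (UNIV - (\<Union>j\<in>V. A j)) = 0" "emeasure M2 (UNIV - (\<Union>j\<in>V. A j)) = 0"
    and p: "0 \<le> p"
  defines "b \<equiv> \<lambda>j. measure M1 (A j) - measure M2 (A j)"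
    and "E \<equiv> \<lambda>i j. setdist (A i) (A j) powr p"
  shows "\<exists>g. (\<forall>i\<in>{j\<in>V. b j > 0}. \<forall>j\<in>{j\<in>V. b j < 0}. 0 \<le> g i j)
    \<and> (\<forall>i\<in>{j\<in>V. b j > 0}. (\<Sum>j\<in>{j\<in>V. b j < 0}. g i j) = b i)
    \<and> (\<forall>j\<in>{j\<in>V. b j < 0}. (\<Sum>i\<in>{j\<in>V. b j > 0}. g i j) = - b j)
    \<and> ennreal (\<Sum>i\<in>{j\<in>V. b j > 0}. \<Sum>j\<in>{j\<in>V. b j < 0}. g i j * geodesic_dist V E i j)
        \<le> (\<integral>\<^sup>+ z. ennreal (dist (fst z) (snd z) powr p) \<partial>\<pi>)"
proof -
  have sets: "sets \<pi> = sets borel" and marg: "distr \<pi> borel fst = M1" "distr \<pi> borel snd = M2"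
    using \<pi> by (auto simp: couplings_def)
  have sp: "space \<pi> = UNIV" using sets_eq_imp_space_eq[OF sets] by simp
  have fs: "fst \<in> measurable \<pi> (borel :: 'a measure)" "snd \<in> measurable \<pi> (borel :: 'a measure)"
    unfolding measurable_cong_sets[OF sets refl]
    by (auto intro!: borel_measurable_continuous_onI continuous_intros)
  have v: "fst -` B = B \<times> UNIV" "snd -` B = UNIV \<times> B" for B :: "'a set" by auto
  have em: "emeasure \<pi> (B \<times> UNIV) = emeasure M1 B" "emeasure \<pi> (UNIV \<times> B) = emeasure M2 B"
    if "B \<in> sets borel" for B
    unfolding marg[symmetric] using that fs by (simp_all add: emeasure_distr sp v)
  interpret M1: finite_measure M1 by fact
  interpret finite_measure \<pi>
    using em(1)[of UNIV] by (intro finite_measureI) (simp add: sp)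
  have Ab: "A j \<in> sets borel" if "j \<in> V" for j using A[OF that] by auto
  have Ub: "(\<Union>j\<in>V. A j) \<in> sets borel" using Ab V by auto
  have AA: "A i \<times> A j \<in> sets borel" if "i \<in> V" "j \<in> V" for i j
    using A that by (intro borel_closed closed_Times) auto
  define f where "f i j = measure \<pi> (A i \<times> A j)" for i j
  have row: "(\<Sum>j\<in>V. f i j) = measure M1 (A i)" if "i \<in> V" for i
  proof -
    \<comment> \<open>The second marginal does not charge the complement of the union, so \<pi>
      lives on the strips \<open>A i \<times> A j\<close>.\<close>
    have "emeasure \<pi> (A i \<times> UNIV) = emeasure \<pi> (\<Union>j\<in>V. A i \<times> A j)"
    proof (rule emeasure_eq_AE)
      show "AE z in \<pi>. z \<in> A i \<times> UNIV \<longleftrightarrow> z \<in> (\<Union>j\<in>V. A i \<times> A j)"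
        by (rule AE_I[where N = "UNIV \<times> (UNIV - (\<Union>j\<in>V. A j))"]) (use em(2) null Ub sets in auto)
    qed (use sets Ab AA that V in auto)
    then have "measure M1 (A i) = measure \<pi> (\<Union>j\<in>V. A i \<times> A j)"
      using em(1)[OF Ab[OF that]] by (simp add: measure_def)
    also have "\<dots> = (\<Sum>j\<in>V. f i j)" unfolding f_def
      using V AA that sets disj
      by (intro finite_measure_finite_Union) (auto simp: disjoint_family_on_def Times_Int_Times)
    finally show ?thesis by simp
  qed
  have col: "(\<Sum>j\<in>V. f j i) = measure M2 (A i)" if "i \<in> V" for i
  proof -
    have "emeasure \<pi> (UNIV \<times> A i) = emeasure \<pi> (\<Union>j\<in>V. A j \<times> A i)"
    proof (rule emeasure_eq_AE)
      show "AE z in \<pi>. z \<in> UNIV \<times> A i \<longleftrightarrow> z \<in> (\<Union>j\<in>V. A j \<times> A i)"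
        by (rule AE_I[where N = "(UNIV - (\<Union>j\<in>V. A j)) \<times> UNIV"]) (use em(1) null Ub sets in auto)
    qed (use sets Ab AA that V in auto)
    then have "measure M2 (A i) = measure \<pi> (\<Union>j\<in>V. A j \<times> A i)"
      using em(2)[OF Ab[OF that]] by (simp add: measure_def)
    also have "\<dots> = (\<Sum>j\<in>V. f j i)" unfolding f_def
      using V AA that sets disj
      by (intro finite_measure_finite_Union) (auto simp: disjoint_family_on_def Times_Int_Times)
    finally show ?thesis by simp
  qed
  have E0: "0 \<le> E i j" for i j by (simp add: E_def)
  have "ennreal (\<Sum>i\<in>V. \<Sum>j\<in>V. f i j * E i j) = (\<Sum>i\<in>V. \<Sum>j\<in>V. ennreal (E i j) * emeasure \<pi> (A i \<times> A j))"
    by (simp add: f_def E0 emeasure_eq_measure sum_ennreal[symmetric] sum_nonneg ennreal_mult mult.commute)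
  also have "\<dots> = (\<Sum>i\<in>V. \<Sum>j\<in>V. \<integral>\<^sup>+ z. ennreal (E i j) * indicator (A i \<times> A j) z \<partial>\<pi>)"
    using AA sets by (intro sum.cong refl nn_integral_cmult_indicator[symmetric]) auto
  also have "\<dots> = (\<integral>\<^sup>+ z. (\<Sum>i\<in>V. \<Sum>j\<in>V. ennreal (E i j) * indicator (A i \<times> A j) z) \<partial>\<pi>)"
  proof -
    have m: "(\<lambda>z. ennreal (E i j) * indicator (A i \<times> A j) z) \<in> borel_measurable \<pi>" if "i \<in> V" "j \<in> V" for i j
      using AA[OF that] sets by (intro borel_measurable_times_ennreal borel_measurable_indicator) auto
    then show ?thesis by (subst nn_integral_sum) (auto intro!: borel_measurable_sum sum.cong simp: nn_integral_sum)
  qed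
  also have "\<dots> \<le> (\<integral>\<^sup>+ z. ennreal (dist (fst z) (snd z) powr p) \<partial>\<pi>)"
  proof (rule nn_integral_mono)
    fix z :: "'a \<times> 'a"
    obtain x y where z: "z = (x, y)" by (cases z)
    have "(\<Sum>i\<in>V. \<Sum>j\<in>V. ennreal (E i j) * indicator (A i \<times> A j) z)
      \<le> (\<Sum>i\<in>V. \<Sum>j\<in>V. ennreal (dist x y powr p) * (indicator (A i) x * indicator (A j) y))"
    proof (intro sum_mono)
      fix i j
      have "ennreal (E i j) \<le> ennreal (dist x y powr p)" if "x \<in> A i" "y \<in> A j"
        unfolding E_def using setdist_le_dist[OF that] p by (intro ennreal_leI powr_mono2) auto
      then show "ennreal (E i j) * indicator (A i \<times> A j) z \<le> ennreal (dist x y powr p) * (indicator (A i) x * indicator (A j) y)"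
        by (auto simp: z split: split_indicator)
    qed
    \<comment> \<open>By disjointness the indicators add up to that of the union, so no pair of
      points is charged twice.\<close>
    also have "\<dots> = ennreal (dist x y powr p) * (indicator (\<Union>i\<in>V. A i) x * indicator (\<Union>i\<in>V. A i) y)"
      by (simp only: indicator_UN_disjoint[OF V disj] sum_product) (simp only: sum_distrib_left)
    also have "\<dots> \<le> ennreal (dist x y powr p)" by (auto split: split_indicator)
    finally show "(\<Sum>i\<in>V. \<Sum>j\<in>V. ennreal (E i j) * indicator (A i \<times> A j) z) \<le> ennreal (dist (fst z) (snd z) powr p)"
      by (simp add: z)
  qed
  finally have cost: "ennreal (\<Sum>i\<in>V. \<Sum>j\<in>V. f i j * E i j) \<le> (\<integral>\<^sup>+ z. ennreal (dist (fst z) (snd z) powr p) \<partial>\<pi>)" .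
  have le: "(\<Sum>i\<in>V. \<Sum>j\<in>V. f i j * geodesic_dist V E i j) \<le> (\<Sum>i\<in>V. \<Sum>j\<in>V. f i j * E i j)"
    by (intro sum_mono mult_left_mono geodesic_dist_le_edge E0) (simp_all add: f_def)
  obtain g where g: "\<forall>i\<in>{j\<in>V. b j > 0}. \<forall>j\<in>{j\<in>V. b j < 0}. 0 \<le> g i j"
    "\<forall>i\<in>{j\<in>V. b j > 0}. (\<Sum>j\<in>{j\<in>V. b j < 0}. g i j) = b i"
    "\<forall>j\<in>{j\<in>V. b j < 0}. (\<Sum>i\<in>{j\<in>V. b j > 0}. g i j) = - b j"
    "(\<Sum>i\<in>{j\<in>V. b j > 0}. \<Sum>j\<in>{j\<in>V. b j < 0}. g i j * geodesic_dist V E i j)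
      \<le> (\<Sum>i\<in>V. \<Sum>j\<in>V. f i j * geodesic_dist V E i j)"
  proof (atomize_elim, rule flow_to_plan)
    show "geodesic_dist V E i l \<le> geodesic_dist V E i j + geodesic_dist V E j l"
      if "i \<in> V" "j \<in> V" "l \<in> V" for i j l
      using that by (intro geodesic_dist_triangle E0)
  qed (use V row col in \<open>auto simp: b_def f_def intro: geodesic_dist_nonneg E0\<close>)
  then show ?thesis
    using order_trans[OF ennreal_leI[OF order_trans[OF g(4) le]] cost]
    by (intro exI[of _ g] conjI)
qed

section \<open>Upper bound\<close>

text \<open>Three plans run side by side: \<open>\<nu>p\<close> is gathered into blobs at the base
  points \<open>a j\<close>, the matrix \<open>l\<close> moves mass between blobs, and blobs are
  spread out into \<open>\<nu>m\<close>. The blobs cancel as catalyst. Each unit of mass handled by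
  any of the three costs an extra \<eta>, whence the factor in the error term.\<close>

lemma catalytic_plan_of_transport:
  fixes A :: "nat \<Rightarrow> 'a::euclidean_space set"
  assumes p: "1 < p" and \<Omega>: "closed \<Omega>"
    and \<mu>: "finite_measure \<mu>" "sets \<mu> = sets borel" "emeasure \<mu> (UNIV - \<Omega>) = 0"
    and \<nu>p: "finite_measure \<nu>p" "sets \<nu>p = sets borel" "emeasure \<nu>p (UNIV - (\<Union>j\<in>V. A j)) = 0"
    and \<nu>m: "finite_measure \<nu>m" "sets \<nu>m = sets borel" "emeasure \<nu>m (UNIV - (\<Union>j\<in>V. A j)) = 0"
    and V: "finite V" and A: "\<And>j. j \<in> V \<Longrightarrow> compact (A j)" "\<And>j. j \<in> V \<Longrightarrow> A j \<subseteq> \<Omega>"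
    and disj: "disjoint_family_on A V"
    and a: "\<And>j. j \<in> V \<Longrightarrow> a j \<in> supp \<mu>"
    and within: "\<And>j x. j \<in> V \<Longrightarrow> x \<in> A j \<Longrightarrow> linked p \<Omega> \<mu> x (a j) 0"
    and between: "\<And>i j. i \<in> V \<Longrightarrow> j \<in> V \<Longrightarrow> linked p \<Omega> \<mu> (a i) (a j) (d i j)"
    and d0: "\<And>i j. i \<in> V \<Longrightarrow> j \<in> V \<Longrightarrow> 0 \<le> d i j"
    and \<eta>: "0 < \<eta>"
  defines "b \<equiv> \<lambda>j. measure \<nu>p (A j) - measure \<nu>m (A j)"
  defines "Vp \<equiv> {j\<in>V. b j > 0}" and "Vm \<equiv> {j\<in>V. b j < 0}"
  assumes l0: "\<And>i j. i \<in> Vp \<Longrightarrow> j \<in> Vm \<Longrightarrow> 0 \<le> l i j"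
    and lp: "\<And>i. i \<in> Vp \<Longrightarrow> (\<Sum>j\<in>Vm. l i j) = b i"
    and lm: "\<And>j. j \<in> Vm \<Longrightarrow> (\<Sum>i\<in>Vp. l i j) = - b j"
  shows "catalytic_plan p \<Omega> \<mu> (emeasure \<nu>p) (emeasure \<nu>m)
    (ennreal ((\<Sum>i\<in>Vp. \<Sum>j\<in>Vm. l i j * d i j)
      + \<eta> * ((\<Sum>j\<in>V. measure \<nu>p (A j)) + (\<Sum>j\<in>V. measure \<nu>m (A j)) + (\<Sum>i\<in>Vp. b i))))"
proof -
  interpret P: finite_measure \<nu>p by fact
  interpret M: finite_measure \<nu>m by fact
  have Vpm: "finite Vp" "finite Vm" "\<And>i. i \<in> Vp \<Longrightarrow> i \<in> V" "\<And>i. i \<in> Vm \<Longrightarrow> i \<in> V"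
    using V by (auto simp: Vp_def Vm_def)
  have "\<forall>\<^sub>F r in at_right 0. \<forall>j\<in>V. \<forall>\<theta>. concentrated_at \<Omega> (a j) r \<theta> \<longrightarrow>
      catalytic_plan p \<Omega> \<mu> (\<lambda>B. emeasure \<nu>p (B \<inter> A j)) (\<lambda>B. emeasure \<nu>p (A j) * emeasure \<theta> B) (emeasure \<nu>p (A j) * ennreal \<eta>)"
    by (intro eventually_ball_finite V ballI gather_measure p \<Omega> \<mu> \<nu>p A within \<eta>)
  moreover have "\<forall>\<^sub>F r in at_right 0. \<forall>j\<in>V. \<forall>\<theta>. concentrated_at \<Omega> (a j) r \<theta> \<longrightarrow>
      catalytic_plan p \<Omega> \<mu> (\<lambda>B. emeasure \<nu>m (B \<inter> A j)) (\<lambda>B. emeasure \<nu>m (A j) * emeasure \<theta> B) (emeasure \<nu>m (A j) * ennreal \<eta>)"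
    by (intro eventually_ball_finite V ballI gather_measure p \<Omega> \<mu> \<nu>m A within \<eta>)
  moreover have "\<forall>\<^sub>F r in at_right 0. \<forall>i\<in>V. \<forall>j\<in>V. \<forall>\<theta>0 \<theta>1. concentrated_at \<Omega> (a i) r \<theta>0 \<longrightarrow> concentrated_at \<Omega> (a j) r \<theta>1 \<longrightarrow>
      catalytic_plan p \<Omega> \<mu> (emeasure \<theta>0) (emeasure \<theta>1) (ennreal (d i j + \<eta>))"
  proof (intro eventually_ball_finite V ballI)
    fix i j assume "i \<in> V" "j \<in> V"
    from between[OF this] \<eta> show "\<forall>\<^sub>F r in at_right 0. \<forall>\<theta>0 \<theta>1. concentrated_at \<Omega> (a i) r \<theta>0 \<longrightarrow> concentrated_at \<Omega> (a j) r \<theta>1 \<longrightarrow>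
      catalytic_plan p \<Omega> \<mu> (emeasure \<theta>0) (emeasure \<theta>1) (ennreal (d i j + \<eta>))"
      unfolding linked_def by simp
  qed
  moreover note eventually_at_right_less[of "0::real"]
  ultimately have "\<forall>\<^sub>F r in at_right (0::real). 0 < r \<and>
    catalytic_plan p \<Omega> \<mu> (emeasure \<nu>p) (emeasure \<nu>m)
    (ennreal ((\<Sum>i\<in>Vp. \<Sum>j\<in>Vm. l i j * d i j)
      + \<eta> * ((\<Sum>j\<in>V. measure \<nu>p (A j)) + (\<Sum>j\<in>V. measure \<nu>m (A j)) + (\<Sum>i\<in>Vp. b i))))"
  proof eventually_elim
    case (elim r)
    have "\<exists>\<theta>. concentrated_at \<Omega> (a j) r \<theta> \<and>
      (\<exists>C\<ge>0. \<forall>B\<in>sets borel. emeasure \<theta> B \<le> ennreal C * emeasure \<mu> B)" if "j \<in> V" for j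
      using blob[OF p \<Omega> \<mu> a[OF that] elim(4)] by metis
    then obtain \<theta> where \<theta>: "\<And>j. j \<in> V \<Longrightarrow> concentrated_at \<Omega> (a j) r (\<theta> j)"
      "\<And>j. j \<in> V \<Longrightarrow> \<exists>C\<ge>0. \<forall>B\<in>sets borel. emeasure (\<theta> j) B \<le> ennreal C * emeasure \<mu> B"
      by metis
    let ?P = "\<lambda>j. measure \<nu>p (A j)" and ?M = "\<lambda>j. measure \<nu>m (A j)"
    have 1: "catalytic_plan p \<Omega> \<mu> (\<lambda>B. \<Sum>j\<in>V. emeasure \<nu>p (B \<inter> A j)) (\<lambda>B. \<Sum>j\<in>V. ennreal (?P j) * emeasure (\<theta> j) B)
      (\<Sum>j\<in>V. ennreal (?P j) * ennreal \<eta>)"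
      using elim(1) \<theta> unfolding P.emeasure_eq_measure[of "A _"] by (intro catalytic_plan_sum V) auto
    have 2: "catalytic_plan p \<Omega> \<mu> (\<lambda>B. \<Sum>j\<in>V. ennreal (?M j) * emeasure (\<theta> j) B) (\<lambda>B. \<Sum>j\<in>V. emeasure \<nu>m (B \<inter> A j))
      (\<Sum>j\<in>V. ennreal (?M j) * ennreal \<eta>)"
      by (rule catalytic_plan_sum[OF V], rule catalytic_plan_swap)
        (use elim(2) \<theta> in \<open>auto simp: M.emeasure_eq_measure[of "A _"]\<close>)
    have 3: "catalytic_plan p \<Omega> \<mu> (\<lambda>B. \<Sum>i\<in>Vp. \<Sum>j\<in>Vm. ennreal (l i j) * emeasure (\<theta> i) B)
      (\<lambda>B. \<Sum>i\<in>Vp. \<Sum>j\<in>Vm. ennreal (l i j) * emeasure (\<theta> j) B) (\<Sum>i\<in>Vp. \<Sum>j\<in>Vm. ennreal (l i j) * ennreal (d i j + \<eta>))"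
      using elim(3) \<theta> Vpm by (intro catalytic_plan_sum catalytic_plan_scale) auto
    have part: "(\<Sum>j\<in>V. emeasure \<nu> (B \<inter> A j)) = emeasure \<nu> B"
      if "sets \<nu> = sets borel" "emeasure \<nu> (UNIV - (\<Union>j\<in>V. A j)) = 0" "B \<in> sets borel" for \<nu> B
    proof -
      have Ab: "A j \<in> sets borel" if "j \<in> V" for j using A(1)[OF that] by (rule borel_compact)
      then have Ub: "(\<Union>j\<in>V. A j) \<in> sets borel" using V by auto
      have "disjoint_family_on (\<lambda>j. B \<inter> A j) V"
        using disj unfolding disjoint_family_on_def by blast
      then have "(\<Sum>j\<in>V. emeasure \<nu> (B \<inter> A j)) = emeasure \<nu> (\<Union>j\<in>V. B \<inter> A j)"
        using V Ab that by (intro sum_emeasure) auto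
      also have "\<dots> = emeasure \<nu> B"
      proof (rule emeasure_eq_AE)
        show "AE x in \<nu>. x \<in> (\<Union>j\<in>V. B \<inter> A j) \<longleftrightarrow> x \<in> B"
          by (rule AE_I[where N = "UNIV - (\<Union>j\<in>V. A j)"]) (use that Ub in auto)
      qed (use that Ab V in auto)
      finally show ?thesis .
    qed
    \<comment> \<open>The books balance at each blob: as a source it provides \<open>?M j\<close>
      for spreading plus the positive part of \<open>b j\<close>, as a target it receives
      \<open>?P j\<close> plus the negative part. Both totals equal
      \<open>max (?P j) (?M j)\<close>, so the same multiple of the blob occurs on both
      sides.\<close>
    have src: "(\<Sum>j\<in>V. ennreal (?M j) * t j) + (\<Sum>i\<in>Vp. \<Sum>j\<in>Vm. ennreal (l i j) * t i) = (\<Sum>j\<in>V. ennreal (max (?P j) (?M j)) * t j)"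
      for t :: "nat \<Rightarrow> ennreal"
    proof -
      have "(\<Sum>i\<in>Vp. \<Sum>j\<in>Vm. ennreal (l i j) * t i) = (\<Sum>i\<in>Vp. ennreal (b i) * t i)"
        using l0 lp by (intro sum.cong refl) (simp add: sum_distrib_right[symmetric] sum_ennreal)
      also have "\<dots> = (\<Sum>i\<in>V. if b i > 0 then ennreal (b i) * t i else 0)"
        unfolding Vp_def using V by (rule sum.inter_filter)
      finally show ?thesis
        by (simp add: sum.distrib[symmetric], intro sum.cong refl)
          (auto simp: b_def max_def distrib_right[symmetric] simp flip: ennreal_plus)
    qed
    have tgt: "(\<Sum>j\<in>V. ennreal (?P j) * t j) + (\<Sum>i\<in>Vp. \<Sum>j\<in>Vm. ennreal (l i j) * t j) = (\<Sum>j\<in>V. ennreal (max (?P j) (?M j)) * t j)"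
      for t :: "nat \<Rightarrow> ennreal"
    proof -
      have "(\<Sum>i\<in>Vp. \<Sum>j\<in>Vm. ennreal (l i j) * t j) = (\<Sum>j\<in>Vm. \<Sum>i\<in>Vp. ennreal (l i j) * t j)"
        by (rule sum.swap)
      also have "\<dots> = (\<Sum>j\<in>Vm. ennreal (- b j) * t j)"
        using l0 lm by (intro sum.cong refl) (simp add: sum_distrib_right[symmetric] sum_ennreal)
      also have "\<dots> = (\<Sum>j\<in>V. if b j < 0 then ennreal (- b j) * t j else 0)"
        unfolding Vm_def using V by (rule sum.inter_filter)
      finally show ?thesis
        by (simp add: sum.distrib[symmetric], intro sum.cong refl)
          (auto simp: b_def max_def distrib_right[symmetric] simp flip: ennreal_plus)
    qed
    have cost: "(\<Sum>j\<in>V. ennreal (?P j) * ennreal \<eta>) + (\<Sum>j\<in>V. ennreal (?M j) * ennreal \<eta>)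
        + (\<Sum>i\<in>Vp. \<Sum>j\<in>Vm. ennreal (l i j) * ennreal (d i j + \<eta>))
      = ennreal ((\<Sum>i\<in>Vp. \<Sum>j\<in>Vm. l i j * d i j)
        + \<eta> * ((\<Sum>j\<in>V. ?P j) + (\<Sum>j\<in>V. ?M j) + (\<Sum>i\<in>Vp. b i)))"
    proof -
      have s: "(\<Sum>j\<in>V. ennreal (h j) * ennreal \<eta>) = ennreal (\<eta> * (\<Sum>j\<in>V. h j))" if "\<And>j. 0 \<le> h j" for h
        using that \<eta> by (simp add: ennreal_mult[symmetric] sum_ennreal sum_distrib_left mult.commute)
      have nn: "0 \<le> l i j * (d i j + \<eta>)" if "i \<in> Vp" "j \<in> Vm" for i j
        using l0[OF that] d0[of i j] Vpm that \<eta> by (intro mult_nonneg_nonneg) auto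
      have "(\<Sum>i\<in>Vp. \<Sum>j\<in>Vm. ennreal (l i j) * ennreal (d i j + \<eta>)) = (\<Sum>i\<in>Vp. \<Sum>j\<in>Vm. ennreal (l i j * (d i j + \<eta>)))"
        using l0 d0 Vpm \<eta> by (intro sum.cong refl ennreal_mult[symmetric]) (auto intro: add_nonneg_nonneg)
      also have "\<dots> = (\<Sum>i\<in>Vp. ennreal (\<Sum>j\<in>Vm. l i j * (d i j + \<eta>)))"
        using nn by (intro sum.cong refl sum_ennreal) auto
      also have "\<dots> = ennreal (\<Sum>i\<in>Vp. \<Sum>j\<in>Vm. l i j * (d i j + \<eta>))"
        using nn by (intro sum_ennreal sum_nonneg) auto
      also have "(\<Sum>i\<in>Vp. \<Sum>j\<in>Vm. l i j * (d i j + \<eta>)) = (\<Sum>i\<in>Vp. \<Sum>j\<in>Vm. l i j * d i j) + \<eta> * (\<Sum>i\<in>Vp. b i)"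
        by (simp add: distrib_left sum.distrib lp sum_distrib_right[symmetric] mult.commute[of \<eta>])
      finally have t: "(\<Sum>i\<in>Vp. \<Sum>j\<in>Vm. ennreal (l i j) * ennreal (d i j + \<eta>))
        = ennreal ((\<Sum>i\<in>Vp. \<Sum>j\<in>Vm. l i j * d i j) + \<eta> * (\<Sum>i\<in>Vp. b i))" .
      have "0 \<le> (\<Sum>i\<in>Vp. \<Sum>j\<in>Vm. l i j * d i j) + \<eta> * (\<Sum>i\<in>Vp. b i)"
      proof (intro add_nonneg_nonneg sum_nonneg)
        show "0 \<le> l i j * d i j" if "i \<in> Vp" "j \<in> Vm" for i j
          using l0[OF that] d0[of i j] Vpm that by simp
        have "0 \<le> b i" if "i \<in> Vp" for i using that by (simp add: Vp_def)
        then show "0 \<le> \<eta> * (\<Sum>i\<in>Vp. b i)" using \<eta> by (simp add: sum_nonneg)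
      qed
      then show ?thesis
        unfolding s[of ?P, OF measure_nonneg] s[of ?M, OF measure_nonneg] t using \<eta>
        by (simp add: sum_nonneg algebra_simps flip: ennreal_plus)
    qed
    show ?case
    proof (rule conjI[OF elim(4)], rule catalytic_plan_cancel_sum[OF V, of _ _ _ _ "\<lambda>j. ennreal (max (?P j) (?M j))" \<theta>])
      show "catalytic_plan p \<Omega> \<mu> (\<lambda>B. emeasure \<nu>p B + (\<Sum>j\<in>V. ennreal (max (?P j) (?M j)) * emeasure (\<theta> j) B))
        (\<lambda>B. emeasure \<nu>m B + (\<Sum>j\<in>V. ennreal (max (?P j) (?M j)) * emeasure (\<theta> j) B))
        (ennreal ((\<Sum>i\<in>Vp. \<Sum>j\<in>Vm. l i j * d i j)
          + \<eta> * ((\<Sum>j\<in>V. ?P j) + (\<Sum>j\<in>V. ?M j) + (\<Sum>i\<in>Vp. b i))))"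
      proof (rule catalytic_plan_mono[OF catalytic_plan_add[OF catalytic_plan_add[OF 1 2] 3]])
        fix B :: "'a set" assume B: "B \<in> sets borel"
        show "emeasure \<nu>p B + (\<Sum>j\<in>V. ennreal (max (?P j) (?M j)) * emeasure (\<theta> j) B)
          = (\<Sum>j\<in>V. emeasure \<nu>p (B \<inter> A j)) + (\<Sum>j\<in>V. ennreal (?M j) * emeasure (\<theta> j) B)
            + (\<Sum>i\<in>Vp. \<Sum>j\<in>Vm. ennreal (l i j) * emeasure (\<theta> i) B)"
          unfolding src[symmetric] part[OF \<nu>p(2,3) B] by (simp add: add.assoc)
        show "emeasure \<nu>m B + (\<Sum>j\<in>V. ennreal (max (?P j) (?M j)) * emeasure (\<theta> j) B)
          = (\<Sum>j\<in>V. ennreal (?P j) * emeasure (\<theta> j) B) + (\<Sum>j\<in>V. emeasure \<nu>m (B \<inter> A j))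
            + (\<Sum>i\<in>Vp. \<Sum>j\<in>Vm. ennreal (l i j) * emeasure (\<theta> j) B)"
          unfolding tgt[symmetric] part[OF \<nu>m(2,3) B] by (simp add: ac_simps)
      qed (use cost in simp)
    qed (use \<theta> in \<open>auto simp: concentrated_at_def\<close>)
  qed
  \<comment> \<open>The conclusion no longer mentions \<open>r\<close>, and arbitrarily small
    positive radii exist.\<close>
  then show ?thesis by (simp add: eventually_conj_iff)
qed

text \<open>By compactness the distance of consecutive components is attained at some
  \<open>u\<close> and \<open>v\<close>. Walking to \<open>u\<close> inside its component is free,
  and only the jump from \<open>u\<close> to \<open>v\<close> is paid for.\<close>

lemma linked_path:
  fixes A :: "nat \<Rightarrow> 'a::euclidean_space set"
  assumes p: "1 < p" and \<Omega>: "closed \<Omega>"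
    and \<mu>: "finite_measure \<mu>" "sets \<mu> = sets borel" "emeasure \<mu> (UNIV - \<Omega>) = 0"
    and A: "\<And>j. j \<in> V \<Longrightarrow> compact (A j)" "\<And>j. j \<in> V \<Longrightarrow> A j \<noteq> {}" "\<And>j. j \<in> V \<Longrightarrow> A j \<subseteq> supp \<mu>"
    and within: "\<And>j x y. j \<in> V \<Longrightarrow> x \<in> A j \<Longrightarrow> y \<in> A j \<Longrightarrow> linked p \<Omega> \<mu> x y 0"
  shows "ks \<noteq> [] \<Longrightarrow> set ks \<subseteq> V \<Longrightarrow> x \<in> A (hd ks) \<Longrightarrow> y \<in> A (last ks)
    \<Longrightarrow> linked p \<Omega> \<mu> x y (path_length (\<lambda>i j. setdist (A i) (A j) powr p) ks)"
proof (induction ks arbitrary: x)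
  case (Cons i ks)
  show ?case
  proof (cases ks)
    case Nil
    then show ?thesis using Cons.prems within by simp
  next
    case (Cons j ls)
    have V: "i \<in> V" "j \<in> V" using Cons.prems Cons by auto
    obtain u v where uv: "u \<in> A i" "v \<in> A j" "dist u v = setdist (A i) (A j)"
      using setdist_compact_closed[OF A(1)[OF V(1)] compact_imp_closed[OF A(1)[OF V(2)]] A(2)[OF V(1)] A(2)[OF V(2)]]
      by blast
    have in_supp: "u \<in> supp \<mu>" "v \<in> supp \<mu>" using uv V A(3) by auto
    have xu: "linked p \<Omega> \<mu> x u 0" using within Cons.prems uv V by simp
    have uv': "linked p \<Omega> \<mu> u v (setdist (A i) (A j) powr p)"
      using linked_dist[OF p \<Omega> \<mu>, of u v] uv(3) by simp
    have vy: "linked p \<Omega> \<mu> v y (path_length (\<lambda>i j. setdist (A i) (A j) powr p) ks)"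
      using Cons.prems Cons uv by (intro Cons.IH) auto
    have "linked p \<Omega> \<mu> x v (0 + setdist (A i) (A j) powr p)"
      by (intro linked_trans[OF p \<Omega> \<mu> xu uv' in_supp(1)]) auto
    then have "linked p \<Omega> \<mu> x y (0 + setdist (A i) (A j) powr p + path_length (\<lambda>i j. setdist (A i) (A j) powr p) ks)"
      by (intro linked_trans[OF p \<Omega> \<mu> _ vy in_supp(2)] path_length_nonneg) auto
    then show ?thesis using Cons by (simp add: path_length_Cons)
  qed
qed simp

section \<open>Passage to the limit\<close>

lemma emeasure_add_scale_measure:
  assumes "finite_measure M" "finite_measure N" "sets M = sets N" "B \<in> sets M" "0 \<le> e"
  shows "emeasure (add_measure M (scale_measure (ennreal e) N)) B = ennreal (measure M B + e * measure N B)"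
  using assms
  by (simp add: emeasure_add_measure finite_measure.emeasure_eq_measure ennreal_mult)

theorem theorem3:
  fixes p :: real and \<Omega> :: "'a::euclidean_space set" and m :: nat
    and \<mu> \<nu>p \<nu>m :: "'a measure" and \<mu>s :: "nat \<Rightarrow> 'a measure" and ds :: "nat \<Rightarrow> real"
  assumes p: "1 < p"
    and \<Omega>: "compact \<Omega>" "closure (interior \<Omega>) = \<Omega>"
    and \<mu>_prob: "prob_space \<mu>" and \<mu>_borel: "sets \<mu> = sets borel"
    and \<mu>_on: "emeasure \<mu> (UNIV - \<Omega>) = 0"
    and m: "m \<ge> 2"
    and \<mu>s_borel: "\<And>j. j \<in> {1..m} \<Longrightarrow> sets (\<mu>s j) = sets borel"
    and \<mu>_sum: "\<And>A. A \<in> sets borel \<Longrightarrow> emeasure \<mu> A = (\<Sum>j\<in>{1..m}. emeasure (\<mu>s j) A)"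
    and \<mu>s_nonempty: "\<And>j. j \<in> {1..m} \<Longrightarrow> supp (\<mu>s j) \<noteq> {}"
    and \<mu>s_disj: "\<And>i j. i \<in> {1..m} \<Longrightarrow> j \<in> {1..m} \<Longrightarrow> i \<noteq> j \<Longrightarrow> supp (\<mu>s i) \<inter> supp (\<mu>s j) = {}"
    and \<mu>s_conn: "\<And>j. j \<in> {1..m} \<Longrightarrow> ds j \<ge> 1 \<and> strongly_d_connected TYPE('b) (ds j) (\<mu>s j)"
    and \<nu>_borel: "sets \<nu>p = sets borel" "sets \<nu>m = sets borel"
    and \<nu>_fin: "finite_measure \<nu>p" "finite_measure \<nu>m"
    and \<nu>_mass: "emeasure \<nu>p UNIV = emeasure \<nu>m UNIV"
    and \<nu>_supp: "supp \<nu>p \<union> supp \<nu>m \<subseteq> supp \<mu>"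
  shows "((\<lambda>\<epsilon>. \<epsilon> powr (- 1 / p) *
            Wasserstein p \<Omega> (add_measure \<mu> (scale_measure (ennreal \<epsilon>) \<nu>p))
                            (add_measure \<mu> (scale_measure (ennreal \<epsilon>) \<nu>m)))
          \<longlongrightarrow> transport_norm p m \<mu>s \<nu>p \<nu>m powr (1 / p)) (at_right 0)"
proof -
  interpret \<mu>: prob_space \<mu> by fact
  interpret P: finite_measure \<nu>p by fact
  interpret M: finite_measure \<nu>m by fact
  have \<mu>_fin: "finite_measure \<mu>" by unfold_locales
  have cl: "closed \<Omega>" using \<Omega>(1) by (rule compact_imp_closed)
  define V where "V = {1..m}"
  define A where "A j = supp (\<mu>s j)" for j
  define U where "U = (\<Union>j\<in>V. A j)"
  have finV: "finite V" by (simp add: V_def)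
  have A_closed: "closed (A j)" for j by (simp add: A_def closed_supp)
  have U_closed: "closed U" unfolding U_def using finV A_closed by (intro closed_UN) auto
  have A_supp: "A j \<subseteq> supp \<mu>" if "j \<in> V" for j
  proof
    fix x assume x: "x \<in> A j"
    show "x \<in> supp \<mu>" unfolding supp_def
    proof (intro CollectI allI impI)
      fix W :: "'a set" assume W: "open W \<and> x \<in> W"
      then have "0 < emeasure (\<mu>s j) W" using x by (auto simp: A_def supp_def)
      also have "\<dots> \<le> (\<Sum>j\<in>{1..m}. emeasure (\<mu>s j) W)"
        using that by (intro member_le_sum) (auto simp: V_def)
      also have "\<dots> = emeasure \<mu> W" using W by (intro \<mu>_sum[symmetric]) auto
      finally show "0 < emeasure \<mu> W" .
    qed
  qed
  have \<mu>U: "emeasure \<mu> (UNIV - U) = 0"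
  proof -
    have "emeasure (\<mu>s j) (UNIV - U) = 0" if "j \<in> V" for j
    proof -
      have "emeasure (\<mu>s j) (UNIV - U) \<le> emeasure (\<mu>s j) (- A j)"
        using that A_closed[of j] \<mu>s_borel[of j] by (intro emeasure_mono) (auto simp: U_def V_def)
      then show ?thesis
        using emeasure_Compl_supp[of "\<mu>s j"] \<mu>s_borel[of j] that by (simp add: A_def V_def)
    qed
    then show ?thesis using U_closed by (subst \<mu>_sum) (auto simp: V_def)
  qed
  \<comment> \<open>\<open>U\<close> is closed, being a finite union of supports, and \<mu> does not
    charge its open complement. Through the support assumption \<open>\<nu>p\<close> and
    \<open>\<nu>m\<close> live on \<open>U\<close> as well.\<close>
  have supp_U: "supp \<mu> \<subseteq> U"
  proof
    fix x assume "x \<in> supp \<mu>"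
    then have "open (UNIV - U) \<and> x \<in> UNIV - U \<Longrightarrow> 0 < emeasure \<mu> (UNIV - U)"
      unfolding supp_def by blast
    then show "x \<in> U" using U_closed \<mu>U by (auto simp: open_Diff)
  qed
  have \<nu>U: "emeasure \<nu> (UNIV - U) = 0" if "sets \<nu> = sets borel" "supp \<nu> \<subseteq> supp \<mu>" for \<nu>
  proof -
    have "emeasure \<nu> (UNIV - U) \<le> emeasure \<nu> (- supp \<nu>)"
      using that supp_U closed_supp[of \<nu>] by (intro emeasure_mono) auto
    then show ?thesis using emeasure_Compl_supp[OF that(1)] by simp
  qed
  note \<nu>pU = \<nu>U[OF \<nu>_borel(1)] and \<nu>mU = \<nu>U[OF \<nu>_borel(2)]
  have A_\<Omega>: "A j \<subseteq> \<Omega>" if "j \<in> V" for j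
  proof
    fix x assume "x \<in> A j"
    then have "x \<in> supp \<mu>" using A_supp[OF that] by auto
    then have "open (UNIV - \<Omega>) \<and> x \<in> UNIV - \<Omega> \<Longrightarrow> 0 < emeasure \<mu> (UNIV - \<Omega>)"
      unfolding supp_def by blast
    then show "x \<in> \<Omega>" using cl \<mu>_on by (auto simp: open_Diff)
  qed
  have A_compact: "compact (A j)" if "j \<in> V" for j
    using compact_Int_closed[OF \<Omega>(1) A_closed[of j]] A_\<Omega>[OF that] by (simp add: Int_absorb1)
  have A_ne: "A j \<noteq> {}" if "j \<in> V" for j using \<mu>s_nonempty that by (simp add: A_def V_def)
  have disj: "disjoint_family_on A V"
    using \<mu>s_disj unfolding disjoint_family_on_def A_def V_def by blast
  have within: "linked p \<Omega> \<mu> x y 0" if "j \<in> V" "x \<in> A j" "y \<in> A j" for j x y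
  proof (rule linked_strongly_connected[OF p cl \<mu>_fin \<mu>_borel \<mu>_on])
    show "strongly_d_connected TYPE('b) (ds j) (\<mu>s j)" using \<mu>s_conn[of j] that(1) by (simp add: V_def)
  qed (use that A_supp[of j] in \<open>auto simp: A_def\<close>)
  define a where "a j = (SOME x. x \<in> A j)" for j
  have a: "a j \<in> A j" if "j \<in> V" for j using A_ne[OF that] unfolding a_def by (simp add: some_in_eq)
  define E where "E i j = setdist (A i) (A j) powr p" for i j
  have E0: "0 \<le> E i j" for i j by (simp add: E_def)
  define D where "D = geodesic_dist V E"
  have D0: "0 \<le> D i j" if "i \<in> V" "j \<in> V" for i j
    unfolding D_def using that by (intro geodesic_dist_nonneg E0)
  have between: "linked p \<Omega> \<mu> (a i) (a j) (D i j)" if ij: "i \<in> V" "j \<in> V" for i j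
  proof (rule linked_closure)
    fix c assume "D i j < c"
    then obtain ks where ks: "ks \<noteq> []" "hd ks = i" "last ks = j" "set ks \<subseteq> V" "path_length E ks < c"
      unfolding D_def geodesic_dist_less_iff[where V = V and E = E, OF E0 ij] by blast
    have "linked p \<Omega> \<mu> (a i) (a j) (path_length (\<lambda>i j. setdist (A i) (A j) powr p) ks)"
      by (rule linked_path[OF p cl \<mu>_fin \<mu>_borel \<mu>_on A_compact A_ne A_supp within])
        (use ks a ij in auto)
    then show "\<exists>d<c. linked p \<Omega> \<mu> (a i) (a j) d" using ks(5) by (auto simp: E_def[abs_def])
  qed
  define b where "b j = measure \<nu>p (A j) - measure \<nu>m (A j)" for j
  define Vp where "Vp = {j\<in>V. b j > 0}"
  define Vm where "Vm = {j\<in>V. b j < 0}"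
  have sub: "Vp \<subseteq> V" "Vm \<subseteq> V" by (auto simp: Vp_def Vm_def)
  define cost where "cost l = (\<Sum>i\<in>Vp. \<Sum>j\<in>Vm. l i j * D i j)" for l
  define feas where "feas l \<longleftrightarrow> (\<forall>i\<in>Vp. \<forall>j\<in>Vm. l i j \<ge> 0) \<and> (\<forall>i\<in>Vp. (\<Sum>j\<in>Vm. l i j) = b i)
    \<and> (\<forall>j\<in>Vm. (\<Sum>i\<in>Vp. l i j) = - b j)" for l :: "nat \<Rightarrow> nat \<Rightarrow> real"
  define T where "T = transport_norm p m \<mu>s \<nu>p \<nu>m"
  have "nu_bar \<mu>s \<nu>p \<nu>m = b" by (simp add: fun_eq_iff nu_bar_def b_def A_def)
  moreover have "edge_len p \<mu>s = E" by (simp add: fun_eq_iff edge_len_def E_def A_def)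
  ultimately have T: "T = Inf {cost l | l. feas l}"
    unfolding T_def transport_norm_def Let_def feas_def cost_def D_def Vp_def Vm_def V_def by simp
  have cost0: "0 \<le> cost l" if "feas l" for l
    using that sub D0 unfolding cost_def feas_def by (intro sum_nonneg mult_nonneg_nonneg) auto
  have T_le: "T \<le> cost l" if "feas l" for l
    unfolding T using that cost0 by (intro cInf_lower bdd_belowI[of _ 0]) auto
  let ?N = "\<lambda>\<epsilon> \<nu>. add_measure \<mu> (scale_measure (ennreal \<epsilon>) \<nu>)"
  \<comment> \<open>The perturbed marginals differ by \<epsilon> b on the components, so the matrix
    obtained from a coupling becomes admissible after division by \<epsilon>.\<close>
  have lower: "ennreal (\<epsilon> * T) \<le> (\<integral>\<^sup>+ z. ennreal (dist (fst z) (snd z) powr p) \<partial>\<pi>)"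
    if \<epsilon>: "0 < \<epsilon>" and \<pi>: "\<pi> \<in> couplings \<Omega> (?N \<epsilon> \<nu>p) (?N \<epsilon> \<nu>m)" for \<epsilon> \<pi>
  proof -
    have em: "emeasure (?N \<epsilon> \<nu>) B = ennreal (measure \<mu> B + \<epsilon> * measure \<nu> B)"
      if "finite_measure \<nu>" "sets \<nu> = sets borel" "B \<in> sets borel" for \<nu> B
      using emeasure_add_scale_measure[OF \<mu>_fin that(1)] that \<mu>_borel \<epsilon> by simp
    then have me: "measure (?N \<epsilon> \<nu>) B = measure \<mu> B + \<epsilon> * measure \<nu> B"
      if "finite_measure \<nu>" "sets \<nu> = sets borel" "B \<in> sets borel" for \<nu> B
      unfolding measure_def[of "?N \<epsilon> \<nu>"] em[OF that] using \<epsilon> by (intro enn2real_ennreal) simp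
    have fin: "finite_measure (?N \<epsilon> \<nu>p)"
      using em[OF \<nu>_fin(1) \<nu>_borel(1), of "space \<mu>"] \<mu>_borel
      by (intro finite_measureI) (simp add: sets_eq_imp_space_eq[OF \<mu>_borel])
    have null: "emeasure (?N \<epsilon> \<nu>) (UNIV - U) = 0"
      if "finite_measure \<nu>" "sets \<nu> = sets borel" "emeasure \<nu> (UNIV - U) = 0" for \<nu>
      using em[OF that(1,2), of "UNIV - U"] U_closed \<mu>U that(3) by (simp add: measure_def)
    have b': "measure (?N \<epsilon> \<nu>p) (A j) - measure (?N \<epsilon> \<nu>m) (A j) = \<epsilon> * b j" for j
      using A_closed[of j] me[OF \<nu>_fin(1) \<nu>_borel(1)] me[OF \<nu>_fin(2) \<nu>_borel(2)]
      by (simp add: b_def algebra_simps)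
    have Vpm: "Vp = {j\<in>V. \<epsilon> * b j > 0}" "Vm = {j\<in>V. \<epsilon> * b j < 0}"
      using \<epsilon> by (auto simp: Vp_def Vm_def zero_less_mult_iff mult_less_0_iff)
    have nullU: "emeasure (?N \<epsilon> \<nu>p) (UNIV - (\<Union>j\<in>V. A j)) = 0" "emeasure (?N \<epsilon> \<nu>m) (UNIV - (\<Union>j\<in>V. A j)) = 0"
      using null[OF \<nu>_fin(1) \<nu>_borel(1) \<nu>pU] null[OF \<nu>_fin(2) \<nu>_borel(2) \<nu>mU] \<nu>_supp
      by (auto simp: U_def)
    have "0 \<le> p" using p by simp
    note plan = plan_of_coupling[OF \<pi> fin finV A_closed disj nullU this]
    note plan = plan[unfolded b', folded Vpm E_def[abs_def], folded D_def]
    obtain g where g: "\<forall>i\<in>Vp. \<forall>j\<in>Vm. 0 \<le> g i j" "\<forall>i\<in>Vp. (\<Sum>j\<in>Vm. g i j) = \<epsilon> * b i"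
      "\<forall>j\<in>Vm. (\<Sum>i\<in>Vp. g i j) = - (\<epsilon> * b j)"
      "ennreal (\<Sum>i\<in>Vp. \<Sum>j\<in>Vm. g i j * D i j) \<le> (\<integral>\<^sup>+ z. ennreal (dist (fst z) (snd z) powr p) \<partial>\<pi>)"
      using plan by (elim exE conjE) (rule that; assumption)
    define l where "l i j = g i j / \<epsilon>" for i j
    have l: "feas l" unfolding feas_def l_def
      using g(1-3) \<epsilon> by (auto simp: sum_divide_distrib[symmetric])
    have "\<epsilon> * T \<le> \<epsilon> * cost l" using T_le[OF l] \<epsilon> by simp
    also have "\<dots> = (\<Sum>i\<in>Vp. \<Sum>j\<in>Vm. g i j * D i j)"
      using \<epsilon> by (simp add: cost_def l_def sum_divide_distrib[symmetric])
    finally have "\<epsilon> * T \<le> (\<Sum>i\<in>Vp. \<Sum>j\<in>Vm. g i j * D i j)" .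
    then show ?thesis using order_trans[OF ennreal_leI g(4)] by blast
  qed
  have total: "(\<Sum>j\<in>V. measure \<nu> (A j)) = measure \<nu> UNIV"
    if "finite_measure \<nu>" "sets \<nu> = sets borel" "emeasure \<nu> (UNIV - U) = 0" for \<nu>
  proof -
    interpret finite_measure \<nu> by fact
    have "measure \<nu> UNIV = measure \<nu> U + measure \<nu> (UNIV - U)"
      using U_closed that(2) finite_measure_Union[of U "UNIV - U"] by simp
    also have "\<dots> = measure \<nu> U" using that(3) by (simp add: measure_def)
    also have "\<dots> = (\<Sum>j\<in>V. measure \<nu> (A j))"
      unfolding U_def using finV A_closed disj that(2) by (intro finite_measure_finite_Union) auto
    finally show ?thesis by simp
  qed
  define S where "S = (\<Sum>j\<in>V. measure \<nu>p (A j))"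
  have Sp: "S = measure \<nu>p UNIV"
    unfolding S_def using \<nu>_supp by (intro total \<nu>_fin \<nu>_borel \<nu>pU) auto
  have Sm: "(\<Sum>j\<in>V. measure \<nu>m (A j)) = S"
    using total[OF \<nu>_fin(2) \<nu>_borel(2) \<nu>mU] \<nu>_supp \<nu>_mass by (simp add: Sp measure_def)
  \<comment> \<open>An infimum over the empty set would be meaningless, so an admissible matrix is
    exhibited: the product flow has divergence \<open>b\<close> because both total masses equal
    \<open>S\<close>, and reducing it with zero distances yields the matrix. For
    \<open>S = 0\<close> all entries vanish.\<close>
  have feas_ex: "\<exists>l. feas l"
  proof -
    define f where "f i j = measure \<nu>p (A i) * measure \<nu>m (A j) / S" for i j
    have zero: "measure \<nu>p (A i) = 0" "measure \<nu>m (A i) = 0" if "S = 0" "i \<in> V" for i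
      using that Sm finV by (auto simp: S_def sum_nonneg_eq_0_iff)
    have "(\<Sum>j\<in>V. f i j) - (\<Sum>j\<in>V. f j i) = b i" if "i \<in> V" for i
    proof -
      have "(\<Sum>j\<in>V. f i j) = measure \<nu>p (A i) * S / S"
        unfolding f_def sum_divide_distrib[symmetric] sum_distrib_left[symmetric] Sm ..
      moreover have "(\<Sum>j\<in>V. f j i) = S * measure \<nu>m (A i) / S"
        unfolding f_def sum_divide_distrib[symmetric] sum_distrib_right[symmetric] S_def[symmetric] ..
      ultimately show ?thesis using zero[OF _ that] by (cases "S = 0") (auto simp: b_def)
    qed
    moreover have "0 \<le> f i j" for i j by (simp add: f_def Sp)
    ultimately have "\<exists>g. (\<forall>i\<in>Vp. \<forall>j\<in>Vm. 0 \<le> g i j) \<and> (\<forall>i\<in>Vp. (\<Sum>j\<in>Vm. g i j) = b i)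
      \<and> (\<forall>j\<in>Vm. (\<Sum>i\<in>Vp. g i j) = - b j)
      \<and> (\<Sum>i\<in>Vp. \<Sum>j\<in>Vm. g i j * 0) \<le> (\<Sum>i\<in>V. \<Sum>j\<in>V. f i j * 0)"
      unfolding Vp_def Vm_def using finV by (intro flow_to_plan[where d = "\<lambda>i j. 0"]) auto
    then show ?thesis unfolding feas_def by blast
  qed
  have T0: "0 \<le> T" unfolding T using feas_ex cost0 by (intro cInf_greatest) auto
  define I where "I \<epsilon> = (INF \<pi>\<in>couplings \<Omega> (?N \<epsilon> \<nu>p) (?N \<epsilon> \<nu>m).
    \<integral>\<^sup>+ z. ennreal (dist (fst z) (snd z) powr p) \<partial>\<pi>)" for \<epsilon>
  have upper: "\<forall>\<^sub>F \<epsilon> in at_right 0. I \<epsilon> \<le> ennreal (\<epsilon> * (T + \<eta>))" if \<eta>: "0 < \<eta>" for \<eta>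
  proof -
    have "T < T + \<eta> / 2" using \<eta> by simp
    then obtain l where l: "feas l" "cost l < T + \<eta> / 2"
      unfolding T by (subst (asm) cInf_less_iff) (use feas_ex cost0 in \<open>auto intro!: bdd_belowI[of _ 0]\<close>)
    define K where "K = (\<Sum>j\<in>V. measure \<nu>p (A j)) + (\<Sum>j\<in>V. measure \<nu>m (A j)) + (\<Sum>i\<in>Vp. b i)"
    have "0 \<le> (\<Sum>i\<in>Vp. b i)" by (intro sum_nonneg) (simp add: Vp_def)
    then have K: "0 \<le> K" unfolding K_def by (intro add_nonneg_nonneg sum_nonneg[of V]) auto
    \<comment> \<open>One half of \<eta> pays for the near-optimal \<open>l\<close>, the other for
      the error \<open>\<eta>' * K\<close>; the added 1 avoids division by zero when
      \<open>K = 0\<close>.\<close>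
    define \<eta>' where "\<eta>' = \<eta> / (2 * (K + 1))"
    have \<eta>': "0 < \<eta>'" "\<eta>' * K \<le> \<eta> / 2" using \<eta> K by (auto simp: \<eta>'_def field_simps)
    have "catalytic_plan p \<Omega> \<mu> (emeasure \<nu>p) (emeasure \<nu>m) (ennreal (cost l + \<eta>' * K))"
      unfolding cost_def K_def Vp_def Vm_def b_def
    proof (rule catalytic_plan_of_transport[OF p cl \<mu>_fin \<mu>_borel \<mu>_on \<nu>_fin(1) \<nu>_borel(1) _ \<nu>_fin(2) \<nu>_borel(2) _
          finV A_compact A_\<Omega> disj _ _ between D0 \<eta>'(1)])
      show "emeasure \<nu>p (UNIV - \<Union> (A ` V)) = 0" "emeasure \<nu>m (UNIV - \<Union> (A ` V)) = 0"
        using \<nu>pU \<nu>mU \<nu>_supp by (auto simp: U_def)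
      show "a j \<in> supp \<mu>" if "j \<in> V" for j using a A_supp that by blast
      show "linked p \<Omega> \<mu> x (a j) 0" if "j \<in> V" "x \<in> A j" for j x using within a that by blast
    qed (use l(1) in \<open>auto simp: feas_def Vp_def Vm_def b_def\<close>)
    from catalytic_plan_imp_cost_bound[OF this \<mu>_fin \<mu>_borel \<mu>_on cl \<nu>_borel]
    have "\<forall>\<^sub>F \<epsilon> in at_right 0. I \<epsilon> \<le> ennreal \<epsilon> * ennreal (cost l + \<eta>' * K)"
      unfolding I_def .
    then show ?thesis using eventually_at_right_less[of "0::real"]
    proof eventually_elim
      case (elim \<epsilon>)
      have "ennreal \<epsilon> * ennreal (cost l + \<eta>' * K) = ennreal (\<epsilon> * (cost l + \<eta>' * K))"
        using elim(2) cost0[OF l(1)] \<eta>'(1) K by (intro ennreal_mult[symmetric]) auto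
      also have "\<dots> \<le> ennreal (\<epsilon> * (T + \<eta>))"
        using elim(2) l(2) \<eta>'(2) by (intro ennreal_leI mult_left_mono) auto
      finally show ?case using elim(1) by simp
    qed
  qed
  define W where "W \<epsilon> = enn2real (I \<epsilon>)" for \<epsilon>
  have "((\<lambda>\<epsilon>. W \<epsilon> / \<epsilon>) \<longlongrightarrow> T) (at_right 0)"
  proof (rule tendstoI)
    fix e :: real assume e: "0 < e"
    from upper[of "e / 2"] e have "\<forall>\<^sub>F \<epsilon> in at_right 0. I \<epsilon> \<le> ennreal (\<epsilon> * (T + e / 2))" by simp
    then show "\<forall>\<^sub>F \<epsilon> in at_right 0. dist (W \<epsilon> / \<epsilon>) T < e" using eventually_at_right_less[of "0::real"]
    proof eventually_elim
      case (elim \<epsilon>)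
      have "ennreal (\<epsilon> * T) \<le> I \<epsilon>" unfolding I_def using lower elim(2) by (intro INF_greatest) auto
      \<comment> \<open>\<open>enn2real\<close> sends infinity to 0, so the real lower bound for
        \<open>W \<epsilon>\<close> needs the finiteness supplied by the upper bound.\<close>
      moreover from this elim(1) obtain x where "I \<epsilon> = ennreal x" "0 \<le> x"
        by (cases "I \<epsilon>") (auto simp: top_unique)
      ultimately have "\<epsilon> * T \<le> W \<epsilon>" "W \<epsilon> \<le> \<epsilon> * (T + e / 2)"
        using elim T0 e by (simp_all add: W_def)
      then have "T \<le> W \<epsilon> / \<epsilon>" "W \<epsilon> / \<epsilon> \<le> T + e / 2"
        using elim(2) by (simp_all add: field_simps)
      then show ?case using e by (simp add: dist_real_def)
    qed
  qed
  \<comment> \<open>The limit \<open>T\<close> may be 0, where the root is handled through the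
    nonnegativity of \<open>W \<epsilon> / \<epsilon>\<close>.\<close>
  then have "((\<lambda>\<epsilon>. (W \<epsilon> / \<epsilon>) powr (1 / p)) \<longlongrightarrow> T powr (1 / p)) (at_right 0)"
  proof (rule tendsto_powr'[OF _ tendsto_const])
    have "\<forall>\<^sub>F \<epsilon> in at_right 0. 0 \<le> W \<epsilon> / \<epsilon>"
      using eventually_at_right_less[of "0::real"] by eventually_elim (simp add: W_def)
    then show "T \<noteq> 0 \<or> 0 < 1 / p \<and> (\<forall>\<^sub>F \<epsilon> in at_right 0. 0 \<le> W \<epsilon> / \<epsilon>)" using p by simp
  qed
  moreover have "\<forall>\<^sub>F \<epsilon> in at_right 0. (W \<epsilon> / \<epsilon>) powr (1 / p)
    = \<epsilon> powr (- 1 / p) * Wasserstein p \<Omega> (?N \<epsilon> \<nu>p) (?N \<epsilon> \<nu>m)"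
    using eventually_at_right_less[of "0::real"]
  proof eventually_elim
    case (elim \<epsilon>)
    then show ?case
      by (simp add: Wasserstein_def W_def I_def powr_divide powr_minus_divide)
  qed
  ultimately show ?thesis unfolding T_def by (rule Lim_transform_eventually)
qed

end
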